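(* Let $\mathcal C=(M\mid V\mid\Omega\mid\rho)$ be a well-formed configuration, i.e. $\Pi;\Gamma;\Sigma;Q\vdash\mathcal C$ for some contexts $\Pi,\Gamma,\Sigma,Q$. Then either $\mathcal C$ is terminal (i.e. $M=\mathbf{skip}$) or there exists a configuration $\mathcal D$ with $\mathcal C\leadsto\mathcal D$. Moreover, if $\mathcal C$ is not terminal, then there are at most two configurations $\mathcal D$ with $\mathcal C\leadsto\mathcal D$, and $\mathrm{tr}(\mathcal C)=\sum_{\mathcal C\leadsto\mathcal D}\mathrm{tr}(\mathcal D)$, where $\mathrm{tr}(M\mid V\mid\Omega\mid\rho):=\mathrm{tr}\,\rho$.
   Context: This concerns the quantum programming language QPL with inductive types. Types: $A,B ::= X \mid I \mid \mathbf{qbit} \mid A+B \mid A\otimes B \mid \mu X.A$ ($X$ type variables). A type context $\Theta$ is a list of distinct type variables; $\Theta \vdash A$ is derivable by: $\Theta\vdash X$ for $X$ in $\Theta$; $\Theta \vdash I$; $\Theta\vdash \mathbf{qbit}$; closure under $+$ and $\otimes$; if $\Theta, X \vdash A$ then $\Theta \vdash \mu X.A$. Closed types are those with $\cdot \vdash A$. Classical types are generated by $P,R ::= X \mid I \mid P+R \mid P\otimes R \mid \mu X.P$. $\mathbf{bit} := I+I$. $A[B/X]$ is substitution. Terms: $M,N ::= \mathbf{new\ unit}\ u \mid \mathbf{discard}\ x \mid y = \mathbf{copy}\ x \mid \mathbf{new\ qbit}\ q \mid b = \mathbf{measure}\ q \mid q_1,\dots,q_n \mathrel{*}= S \mid M;N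 \mid \mathbf{skip} \mid \mathbf{while}\ b\ \mathbf{do}\ M \mid y = \mathbf{left}_{A,B}\, x \mid y = \mathbf{right}_{A,B}\, x \mid \mathbf{case}\ y\ \mathbf{of}\ \{\mathbf{left}\ x_1 \to M \mid \mathbf{right}\ x_2 \to N\} \mid x = (x_1,x_2) \mid (x_1,x_2) = x \mid y = \mathbf{fold}_{\mu X.A}\, x \mid y = \mathbf{unfold}\ x \mid \mathbf{proc}\ f :: x:A \to y:B\ \{M\} \mid y = f(x)$, where $S$ ranges over unitary $2^n\times 2^n$ matrices (of arity $n$) and $f$ over procedure names. A variable context $\Gamma,\Sigma$ is a finite map from term variables to closed types, written $x_1:A_1,\dots,x_n:A_n$; writing $\Gamma, x:A$ presupposes $x \notin \mathrm{dom}\,\Gamma$. A procedure context $\Pi$ is a finite map from procedure names to pairs of closed types, written $f_1:A_1\to B_1,\dots$. The judgement $\Pi \vdash \langle \Gamma\rangle\ M\ \langle \Sigma\rangle$ is derivable by the rules (all types closed): $\langle\Gamma\rangle\ \mathbf{new\ unit}\ u\ \langle \Gamma, u:I\rangle$; $\langle \Gamma, x:A\rangle\ \mathbf{discard}\ x\ \langle\Gamma\rangle$; for classical $P$: $\langle\Gamma, x:P\rangle\ y=\mathbf{copy}\ x\ \langle \Gamma, x:P, y:P\rangle$; $\langle\Gamma\rangle\ \mathbf{skip}\ \langle\Gamma\rangle$; if $\Pi\vdash\langle\Gamma\rangle M\langle\Gamma'\rangle$ and $\Pi\vdash\langle\Gamma'\rangle N\langle\Sigma\rangle$ then $\Pi\vdash\langle\Gamma\rangle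 M;N\langle\Sigma\rangle$; if $\Pi \vdash \langle\Gamma, b:\mathbf{bit}\rangle M \langle \Gamma, b:\mathbf{bit}\rangle$ then $\Pi\vdash\langle\Gamma,b:\mathbf{bit}\rangle\ \mathbf{while}\ b\ \mathbf{do}\ M\ \langle\Gamma,b:\mathbf{bit}\rangle$; $\langle\Gamma\rangle\ \mathbf{new\ qbit}\ q\ \langle\Gamma,q:\mathbf{qbit}\rangle$; $\langle\Gamma,q:\mathbf{qbit}\rangle\ b=\mathbf{measure}\ q\ \langle\Gamma,b:\mathbf{bit}\rangle$; for $S$ of arity $n$: $\langle\Gamma,q_1:\mathbf{qbit},\dots,q_n:\mathbf{qbit}\rangle\ q_1,\dots,q_n\mathrel{*}=S\ \langle\Gamma,q_1:\mathbf{qbit},\dots,q_n:\mathbf{qbit}\rangle$; $\langle\Gamma,x:A\rangle\ y=\mathbf{left}_{A,B}\,x\ \langle\Gamma,y:A+B\rangle$; $\langle\Gamma,x:B\rangle\ y=\mathbf{right}_{A,B}\,x\ \langle\Gamma,y:A+B\rangle$; if $\Pi\vdash\langle\Gamma,x_1:A\rangle M_1\langle\Sigma\rangle$ and $\Pi\vdash\langle\Gamma,x_2:B\rangle M_2\langle\Sigma\rangle$ then $\Pi\vdash\langle\Gamma,y:A+B\rangle\ \mathbf{case}\ y\ \mathbf{of}\ \{\mathbf{left}\ x_1\to M_1\mid \mathbf{right}\ x_2\to M_2\}\ \langle\Sigma\rangle$; $\langle\Gamma,x_1:A,x_2:B\rangle\ x=(x_1,x_2)\ \langle\Gamma,x:A\otimes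 B\rangle$; $\langle\Gamma,x:A\otimes B\rangle\ (x_1,x_2)=x\ \langle\Gamma,x_1:A,x_2:B\rangle$; $\langle\Gamma,x:A[\mu X.A/X]\rangle\ y=\mathbf{fold}_{\mu X.A}\,x\ \langle\Gamma,y:\mu X.A\rangle$; $\langle\Gamma,x:\mu X.A\rangle\ y=\mathbf{unfold}\ x\ \langle\Gamma,y:A[\mu X.A/X]\rangle$; if $\Pi,f:A\to B\vdash\langle x:A\rangle M\langle y:B\rangle$ then $\Pi\vdash\langle\Gamma\rangle\ \mathbf{proc}\ f::x:A\to y:B\ \{M\}\ \langle\Gamma\rangle$; $\Pi,f:A\to B\vdash\langle\Gamma,x:A\rangle\ y=f(x)\ \langle\Gamma,y:B\rangle$. (Rules without premises hold for every $\Pi$.) Values: $v,w ::= * \mid n \mid \mathbf{left}_{A,B}\,v \mid \mathbf{right}_{A,B}\,v \mid (v,w)\mid \mathbf{fold}_{\mu X.A}\,v$, $n\in\mathbb N$; $\mathtt{ff}:=\mathbf{left}_{I,I}*$, $\mathtt{tt}:=\mathbf{right}_{I,I}*$. A qubit pointer context is a finite $Q\subseteq\mathbb N$; $Q\vdash v:A$ is derivable by: $\varnothing\vdash *:I$; $\{n\}\vdash n:\mathbf{qbit}$; $Q\vdash v:A \Rightarrow Q\vdash\mathbf{left}_{A,B}v:A+B$; $Q\vdash v:B\Rightarrow Q\vdash\mathbf{right}_{A,B}v:A+B$; $Q_1\vdash v:A$, $Q_2\vdash w:B$, $Q_1\cap Q_2=\varnothing\Rightarrow Q_1\cup Q_2\vdash(v,w):A\otimes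 B$; $Q\vdash v:A[\mu X.A/X]\Rightarrow Q\vdash\mathbf{fold}_{\mu X.A}v:\mu X.A$. A value assignment $V=\{x_1=v_1,\dots,x_n=v_n\}$ is a finite map from variables to values; $Q;\Gamma\vdash V$ iff $\mathrm{dom}\,V=\mathrm{dom}\,\Gamma$ and $Q$ is a disjoint union $Q_1\cup\dots\cup Q_n$ with $Q_i\vdash v_i:\Gamma(x_i)$. A procedure store $\Omega$ is a finite set of definitions $f::x:A\to y:B\ \{M\}$; $\Pi\vdash\Omega$ is derivable by $\cdot\vdash\cdot$ and: if $\Pi\vdash\Omega$ and $\Pi,f:A\to B\vdash\langle x:A\rangle M\langle y:B\rangle$ then $\Pi,f:A\to B\vdash\Omega, f::x:A\to y:B\ \{M\}$. A configuration is $(M\mid V\mid\Omega\mid\rho)$ with $M$ a term, $V$ a value assignment, $\Omega$ a procedure store and $\rho\in\mathbb C^{2^n\times 2^n}$ ($n\ge 0$, $\dim(\rho):=n$) a positive semidefinite matrix with $0\le\mathrm{tr}\,\rho\le 1$, whose tensor factors $\mathbb C^2$ are numbered $1,\dots,n$ (qubits). We write $\Pi;\Gamma;\Sigma;Q\vdash(M\mid V\mid\Omega\mid\rho)$ iff $\Pi\vdash\langle\Gamma\rangle M\langle\Sigma\rangle$, $Q;\Gamma\vdash V$, $\Pi\vdash\Omega$ and $Q=\{1,\dots,\dim(\rho)\}$. Reduction $\leadsto$ (writing $V, x=v$ for the extension of $V$ by $x\notin\mathrm{dom}V$): (unit) $(\mathbf{new\ unit}\ u\mid V\mid\Omega\mid\rho)\leadsto(\mathbf{skip}\mid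 V,u=*\mid\Omega\mid\rho)$; (discard) $(\mathbf{discard}\ x\mid V,x=v\mid\Omega\mid\rho)\leadsto(\mathbf{skip}\mid r_v(V)\mid\Omega\mid tr_v(\rho))$; (copy) $(y=\mathbf{copy}\ x\mid V,x=v\mid\Omega\mid\rho)\leadsto(\mathbf{skip}\mid V,x=v,y=v\mid\Omega\mid\rho)$; (qbit) $(\mathbf{new\ qbit}\ q\mid V\mid\Omega\mid\rho)\leadsto(\mathbf{skip}\mid V,q=\dim(\rho)+1\mid\Omega\mid\rho\otimes|0\rangle\langle0|)$; (unitary) $(\vec q\mathrel{*}=S\mid V,\vec q=\vec m\mid\Omega\mid\rho)\leadsto(\mathbf{skip}\mid V,\vec q=\vec m\mid\Omega\mid S_{\vec m}(\rho))$; (measure$i$), $i\in\{0,1\}$: $(b=\mathbf{measure}\ q\mid V,q=m\mid\Omega\mid\rho)\leadsto(\mathbf{skip}\mid r_m(V),b=\beta_i\mid\Omega\mid{}_m\langle i|\rho|i\rangle_m)$ with $\beta_0=\mathtt{ff}$, $\beta_1=\mathtt{tt}$; (seq1) $(\mathbf{skip};N\mid V\mid\Omega\mid\rho)\leadsto(N\mid V\mid\Omega\mid\rho)$; (seq2) if $(M\mid V\mid\Omega\mid\rho)\leadsto(M'\mid V'\mid\Omega'\mid\rho')$ then $(M;N\mid V\mid\Omega\mid\rho)\leadsto(M';N\mid V'\mid\Omega'\mid\rho')$; (while) $(\mathbf{while}\ b\ \mathbf{do}\ M\mid V,b=v\mid\Omega\mid\rho)\leadsto(\mathbf{if}\ b\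 \mathbf{then}\ \{M;\mathbf{while}\ b\ \mathbf{do}\ M\}\mid V,b=v\mid\Omega\mid\rho)$, where $\mathbf{if}\ b\ \mathbf{then}\ \{N\}$ abbreviates $\mathbf{case}\ b\ \mathbf{of}\ \{\mathbf{left}\ u\to b=\mathbf{left}_{I,I}\,u\mid\mathbf{right}\ u\to b=\mathbf{right}_{I,I}\,u;N\}$; (left) $(y=\mathbf{left}\ x\mid V,x=v\mid\Omega\mid\rho)\leadsto(\mathbf{skip}\mid V,y=\mathbf{left}\ v\mid\Omega\mid\rho)$ and similarly (right); (caseLeft) $(\mathbf{case}\ y\ \mathbf{of}\ \{\mathbf{left}\ x_1\to M_1\mid\mathbf{right}\ x_2\to M_2\}\mid V,y=\mathbf{left}\ v\mid\Omega\mid\rho)\leadsto(M_1\mid V,x_1=v\mid\Omega\mid\rho)$ and (caseRight) symmetrically to $(M_2\mid V,x_2=v\mid\Omega\mid\rho)$; (pair) $(x=(x_1,x_2)\mid V,x_1=v_1,x_2=v_2\mid\Omega\mid\rho)\leadsto(\mathbf{skip}\mid V,x=(v_1,v_2)\mid\Omega\mid\rho)$; (unpair) the converse; (fold) $(y=\mathbf{fold}\ x\mid V,x=v\mid\Omega\mid\rho)\leadsto(\mathbf{skip}\mid V,y=\mathbf{fold}\ v\mid\Omega\mid\rho)$; (unfold) $(y=\mathbf{unfold}\ x\mid V,x=\mathbf{fold}\ v\mid\Omega\mid\rho)\leadsto(\mathbf{skip}\mid V,y=v\mid\Omega\mid\rho)$; (proc) $(\mathbf{proc}\ f::x:A\to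 y:B\ \{M\}\mid V\mid\Omega\mid\rho)\leadsto(\mathbf{skip}\mid V\mid\Omega,f::x:A\to y:B\ \{M\}\mid\rho)$; (call) $(y_1=f(x_1)\mid V,x_1=v\mid\Omega,f::x_2:A\to y_2:B\ \{M\}\mid\rho)\leadsto(M_\alpha\mid V,x_1=v\mid\Omega,f::x_2:A\to y_2:B\ \{M\}\mid\rho)$, where $M_\alpha$ is obtained from $M$ by renaming $x_2$ to $x_1$, $y_2$ to $y_1$ and all other variables of $M$ to fresh names (configurations differing only in this choice of fresh names are regarded as the same configuration). Here, for a value $v$ with $Q_v\vdash v:A$: $tr_v(\rho)$ is the partial trace of $\rho$ over the qubits in $Q_v$; $r_v(V)$ replaces each value $w$ of $V$ by $r'_v(w)$, where $r'_v$ maps each pointer $k$ to $k-|\{i\in Q_v: i<k\}|$ and acts homomorphically on $*$, $\mathbf{left}$, $\mathbf{right}$, pairs and $\mathbf{fold}$ (for (measure), $v=m$, $Q_v=\{m\}$); $S_{\vec m}(\rho)=U\rho U^\dagger$ where $U$ acts as $S$ on qubits $m_1,\dots,m_n$ (in this order) and as identity on the others; $|i\rangle_m=I_{2^{m-1}}\otimes|i\rangle\otimes I_{2^{N-m}}$ with $N=\dim(\rho)$ and ${}_m\langle i|$ its adjoint. *)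

theory Defs
  imports "Jordan_Normal_Form.Schur_Decomposition"
begin

section \<open>Types\<close>

text \<open>
  Types are taken up to renaming of bound type variables, by de Bruijn indices: \<open>TMu A\<close> is
  \<open>\<mu>X. A\<close> with \<open>X\<close> the index \<open>0\<close> of \<open>A\<close>. A type context is represented by its length.
\<close>

datatype ty = TVar nat | TUnit | TQbit | TSum ty ty | TTensor ty ty | TMu ty

primrec wf_ty :: "nat \<Rightarrow> ty \<Rightarrow> bool" where
  "wf_ty n (TVar i) \<longleftrightarrow> i < n"
| "wf_ty n TUnit \<longleftrightarrow> True"
| "wf_ty n TQbit \<longleftrightarrow> True"
| "wf_ty n (TSum A B) \<longleftrightarrow> wf_ty n A \<and> wf_ty n B"
| "wf_ty n (TTensor A B) \<longleftrightarrow> wf_ty n A \<and> wf_ty n B"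
| "wf_ty n (TMu A) \<longleftrightarrow> wf_ty (Suc n) A"

abbreviation closed_ty :: "ty \<Rightarrow> bool" where
  "closed_ty \<equiv> wf_ty 0"

primrec classical :: "ty \<Rightarrow> bool" where
  "classical (TVar i) \<longleftrightarrow> True"
| "classical TUnit \<longleftrightarrow> True"
| "classical TQbit \<longleftrightarrow> False"
| "classical (TSum A B) \<longleftrightarrow> classical A \<and> classical B"
| "classical (TTensor A B) \<longleftrightarrow> classical A \<and> classical B"
| "classical (TMu A) \<longleftrightarrow> classical A"

abbreviation TBit :: ty where
  "TBit \<equiv> TSum TUnit TUnit"

primrec lift_ty :: "nat \<Rightarrow> ty \<Rightarrow> ty" where
  "lift_ty k (TVar i) = (if i < k then TVar i else TVar (Suc i))"
| "lift_ty k TUnit = TUnit"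
| "lift_ty k TQbit = TQbit"
| "lift_ty k (TSum A B) = TSum (lift_ty k A) (lift_ty k B)"
| "lift_ty k (TTensor A B) = TTensor (lift_ty k A) (lift_ty k B)"
| "lift_ty k (TMu A) = TMu (lift_ty (Suc k) A)"

text \<open>\<open>subst_ty A k B\<close> replaces the variable with index \<open>k\<close> of \<open>A\<close> by \<open>B\<close> and removes it from the
  type context; so \<open>A[B/X]\<close> is \<open>subst_ty A 0 B\<close>.\<close>

primrec subst_ty :: "ty \<Rightarrow> nat \<Rightarrow> ty \<Rightarrow> ty" where
  "subst_ty (TVar i) k B = (if i < k then TVar i else if i = k then B else TVar (i - 1))"
| "subst_ty TUnit k B = TUnit"
| "subst_ty TQbit k B = TQbit"
| "subst_ty (TSum A1 A2) k B = TSum (subst_ty A1 k B) (subst_ty A2 k B)"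
| "subst_ty (TTensor A1 A2) k B = TTensor (subst_ty A1 k B) (subst_ty A2 k B)"
| "subst_ty (TMu A) k B = TMu (subst_ty A (Suc k) (lift_ty 0 B))"

abbreviation unroll :: "ty \<Rightarrow> ty" where
  "unroll A \<equiv> subst_ty A 0 (TMu A)"


section \<open>Matrices on qubits\<close>

definition mat_trace :: "complex mat \<Rightarrow> complex" where
  "mat_trace A = (\<Sum>i<dim_row A. A $$ (i, i))"

definition unitary_mat :: "complex mat \<Rightarrow> bool" where
  "unitary_mat A \<longleftrightarrow> square_mat A \<and>
     A * mat_adjoint A = 1\<^sub>m (dim_row A) \<and> mat_adjoint A * A = 1\<^sub>m (dim_row A)"

definition psd_mat :: "complex mat \<Rightarrow> bool" where
  "psd_mat A \<longleftrightarrow> square_mat A \<and> mat_adjoint A = A \<and>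
     (\<forall>v \<in> carrier_vec (dim_row A). 0 \<le> Re ((A *\<^sub>v v) \<bullet>c v))"

text \<open>The \<open>n\<close> of a matrix with \<open>2 ^ n\<close> rows.\<close>

definition qubits :: "complex mat \<Rightarrow> nat" where
  "qubits A = (THE n. dim_row A = 2 ^ n)"

text \<open>Kronecker product: the row (column) index of the left factor is the more significant one.\<close>

definition kron :: "complex mat \<Rightarrow> complex mat \<Rightarrow> complex mat" where
  "kron A B = mat (dim_row A * dim_row B) (dim_col A * dim_col B)
     (\<lambda>(i, j). A $$ (i div dim_row B, j div dim_col B) * B $$ (i mod dim_row B, j mod dim_col B))"

definition ket :: "nat \<Rightarrow> complex mat" where
  "ket i = mat 2 1 (\<lambda>(r, c). if r = i then 1 else 0)"

definition ket_at :: "nat \<Rightarrow> nat \<Rightarrow> nat \<Rightarrow> complex mat" where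
  "ket_at N m i = kron (kron (1\<^sub>m (2 ^ (m - 1))) (ket i)) (1\<^sub>m (2 ^ (N - m)))"

definition measure_branch :: "nat \<Rightarrow> nat \<Rightarrow> complex mat \<Rightarrow> complex mat" where
  "measure_branch m i \<rho> =
     mat_adjoint (ket_at (qubits \<rho>) m i) * \<rho> * ket_at (qubits \<rho>) m i"

definition partial_trace1 :: "nat \<Rightarrow> complex mat \<Rightarrow> complex mat" where
  "partial_trace1 m \<rho> = measure_branch m 0 \<rho> + measure_branch m 1 \<rho>"

text \<open>The qubits of a finite set are traced out one by one, the one with the largest number first
  (\<open>foldr\<close> starts at the end of the list), so that those still to be traced out keep their numbers.\<close>

definition partial_trace :: "nat set \<Rightarrow> complex mat \<Rightarrow> complex mat" where
  "partial_trace Q \<rho> = foldr partial_trace1 (sorted_list_of_set Q) \<rho>"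

text \<open>\<open>qubit_of N k i\<close> is the value of qubit \<open>k\<close> (qubit \<open>1\<close> is the most significant bit) in the
  basis state \<open>i < 2 ^ N\<close>; \<open>subindex N ms i\<close> is the basis state of the qubits \<open>ms\<close>, in this order.\<close>

definition qubit_of :: "nat \<Rightarrow> nat \<Rightarrow> nat \<Rightarrow> nat" where
  "qubit_of N k i = i div 2 ^ (N - k) mod 2"

definition subindex :: "nat \<Rightarrow> nat list \<Rightarrow> nat \<Rightarrow> nat" where
  "subindex N ms i = foldl (\<lambda>a m. 2 * a + qubit_of N m i) 0 ms"

text \<open>The operator on \<open>N\<close> qubits that acts as \<open>S\<close> on the distinct qubits \<open>ms\<close> and as the identity
  on the others.\<close>

definition act_on :: "nat \<Rightarrow> nat list \<Rightarrow> complex mat \<Rightarrow> complex mat" where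
  "act_on N ms S = mat (2 ^ N) (2 ^ N)
     (\<lambda>(i, j). if \<forall>k \<in> {1..N} - set ms. qubit_of N k i = qubit_of N k j
               then S $$ (subindex N ms i, subindex N ms j) else 0)"

definition apply_gate :: "nat list \<Rightarrow> complex mat \<Rightarrow> complex mat \<Rightarrow> complex mat" where
  "apply_gate ms S \<rho> =
     act_on (qubits \<rho>) ms S * \<rho> * mat_adjoint (act_on (qubits \<rho>) ms S)"

typedef gate = "{S :: complex mat. \<exists>n. S \<in> carrier_mat (2 ^ n) (2 ^ n) \<and> unitary_mat S}"
  morphisms gate_mat Gate
proof
  have "mat_adjoint (1\<^sub>m 1 :: complex mat) = 1\<^sub>m 1"
    by (auto simp: mat_adjoint_def mat_of_rows_def)
  then have "unitary_mat (1\<^sub>m 1)"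
    by (simp add: unitary_mat_def)
  then show "1\<^sub>m 1 \<in> {S :: complex mat. \<exists>n. S \<in> carrier_mat (2 ^ n) (2 ^ n) \<and> unitary_mat S}"
    by (auto intro: exI[of _ 0])
qed

definition arity :: "gate \<Rightarrow> nat" where
  "arity S = qubits (gate_mat S)"


section \<open>Terms\<close>

type_synonym var = string
type_synonym pname = string

text \<open>
  The result variable comes first: \<open>Measure b q\<close> is \<open>b = measure q\<close>, \<open>Pair x x1 x2\<close> is
  \<open>x = (x1, x2)\<close>, \<open>Unpair x1 x2 x\<close> is \<open>(x1, x2) = x\<close>, and \<open>Call y f x\<close> is \<open>y = f(x)\<close>.
  \<open>Case y x1 M x2 N\<close> is \<open>case y of {left x1 \<rightarrow> M | right x2 \<rightarrow> N}\<close>.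
  \<open>Fold A y x\<close> is \<open>y = fold x\<close> with annotation \<open>\<mu>X. A\<close>, that is, \<open>TMu A\<close>.
  \<open>vars M\<close> is the set of all variables occurring in \<open>M\<close> (including those in nested procedure
  definitions), and \<open>rename r M\<close> applies \<open>r\<close> to each of them.
\<close>

datatype (vars: 'v) trm =
    NewUnit 'v
  | Discard 'v
  | Copy 'v 'v
  | NewQbit 'v
  | Measure 'v 'v
  | Apply "'v list" gate
  | Seq "'v trm" "'v trm"
  | Skip
  | While 'v "'v trm"
  | InLeft ty ty 'v 'v
  | InRight ty ty 'v 'v
  | Case 'v 'v "'v trm" 'v "'v trm"
  | Pair 'v 'v 'v
  | Unpair 'v 'v 'v
  | Fold ty 'v 'v
  | Unfold 'v 'v
  | Proc pname 'v ty 'v ty "'v trm"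
  | Call 'v pname 'v
  for map: rename

type_synonym var_ctx = "var \<rightharpoonup> ty"
type_synonym proc_ctx = "pname \<rightharpoonup> ty \<times> ty"

definition wf_var_ctx :: "var_ctx \<Rightarrow> bool" where
  "wf_var_ctx \<Gamma> \<longleftrightarrow> finite (dom \<Gamma>) \<and> (\<forall>A \<in> ran \<Gamma>. closed_ty A)"

definition wf_proc_ctx :: "proc_ctx \<Rightarrow> bool" where
  "wf_proc_ctx \<Phi> \<longleftrightarrow> finite (dom \<Phi>) \<and> (\<forall>(A, B) \<in> ran \<Phi>. closed_ty A \<and> closed_ty B)"

text \<open>A rule requires closedness of those types only that do not already occur in its left-hand
  context; see \<open>typed_wf_var_ctx\<close> below.\<close>

inductive typed :: "proc_ctx \<Rightarrow> var_ctx \<Rightarrow> var trm \<Rightarrow> var_ctx \<Rightarrow> bool" where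
  unit: "u \<notin> dom \<Gamma> \<Longrightarrow> typed \<Phi> \<Gamma> (NewUnit u) (\<Gamma>(u \<mapsto> TUnit))"
| discard: "x \<notin> dom \<Gamma> \<Longrightarrow> typed \<Phi> (\<Gamma>(x \<mapsto> A)) (Discard x) \<Gamma>"
| copy: "\<lbrakk>x \<notin> dom \<Gamma>; y \<notin> dom \<Gamma>; x \<noteq> y; classical P\<rbrakk>
    \<Longrightarrow> typed \<Phi> (\<Gamma>(x \<mapsto> P)) (Copy y x) (\<Gamma>(x \<mapsto> P, y \<mapsto> P))"
| skip: "typed \<Phi> \<Gamma> Skip \<Gamma>"
| seq: "\<lbrakk>typed \<Phi> \<Gamma> M \<Gamma>'; typed \<Phi> \<Gamma>' N \<Sigma>\<rbrakk> \<Longrightarrow> typed \<Phi> \<Gamma> (Seq M N) \<Sigma>"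
| while: "\<lbrakk>b \<notin> dom \<Gamma>; typed \<Phi> (\<Gamma>(b \<mapsto> TBit)) M (\<Gamma>(b \<mapsto> TBit))\<rbrakk>
    \<Longrightarrow> typed \<Phi> (\<Gamma>(b \<mapsto> TBit)) (While b M) (\<Gamma>(b \<mapsto> TBit))"
| qbit: "q \<notin> dom \<Gamma> \<Longrightarrow> typed \<Phi> \<Gamma> (NewQbit q) (\<Gamma>(q \<mapsto> TQbit))"
| measure: "\<lbrakk>q \<notin> dom \<Gamma>; b \<notin> dom \<Gamma>\<rbrakk>
    \<Longrightarrow> typed \<Phi> (\<Gamma>(q \<mapsto> TQbit)) (Measure b q) (\<Gamma>(b \<mapsto> TBit))"
| unitary: "\<lbrakk>length qs = arity S; distinct qs; set qs \<inter> dom \<Gamma> = {};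
      \<Gamma>' = \<Gamma>(qs [\<mapsto>] replicate (length qs) TQbit)\<rbrakk>
    \<Longrightarrow> typed \<Phi> \<Gamma>' (Apply qs S) \<Gamma>'"
| left: "\<lbrakk>x \<notin> dom \<Gamma>; y \<notin> dom \<Gamma>; closed_ty B\<rbrakk>
    \<Longrightarrow> typed \<Phi> (\<Gamma>(x \<mapsto> A)) (InLeft A B y x) (\<Gamma>(y \<mapsto> TSum A B))"
| right: "\<lbrakk>x \<notin> dom \<Gamma>; y \<notin> dom \<Gamma>; closed_ty A\<rbrakk>
    \<Longrightarrow> typed \<Phi> (\<Gamma>(x \<mapsto> B)) (InRight A B y x) (\<Gamma>(y \<mapsto> TSum A B))"
| case_of: "\<lbrakk>y \<notin> dom \<Gamma>; x1 \<notin> dom \<Gamma>; x2 \<notin> dom \<Gamma>;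
      typed \<Phi> (\<Gamma>(x1 \<mapsto> A)) M1 \<Sigma>; typed \<Phi> (\<Gamma>(x2 \<mapsto> B)) M2 \<Sigma>\<rbrakk>
    \<Longrightarrow> typed \<Phi> (\<Gamma>(y \<mapsto> TSum A B)) (Case y x1 M1 x2 M2) \<Sigma>"
| pair: "\<lbrakk>x1 \<notin> dom \<Gamma>; x2 \<notin> dom \<Gamma>; x1 \<noteq> x2; x \<notin> dom \<Gamma>\<rbrakk>
    \<Longrightarrow> typed \<Phi> (\<Gamma>(x1 \<mapsto> A, x2 \<mapsto> B)) (Pair x x1 x2) (\<Gamma>(x \<mapsto> TTensor A B))"
| unpair: "\<lbrakk>x1 \<notin> dom \<Gamma>; x2 \<notin> dom \<Gamma>; x1 \<noteq> x2; x \<notin> dom \<Gamma>\<rbrakk>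
    \<Longrightarrow> typed \<Phi> (\<Gamma>(x \<mapsto> TTensor A B)) (Unpair x1 x2 x) (\<Gamma>(x1 \<mapsto> A, x2 \<mapsto> B))"
| fold: "\<lbrakk>x \<notin> dom \<Gamma>; y \<notin> dom \<Gamma>; closed_ty (TMu A)\<rbrakk>
    \<Longrightarrow> typed \<Phi> (\<Gamma>(x \<mapsto> unroll A)) (Fold A y x) (\<Gamma>(y \<mapsto> TMu A))"
| unfold: "\<lbrakk>x \<notin> dom \<Gamma>; y \<notin> dom \<Gamma>\<rbrakk>
    \<Longrightarrow> typed \<Phi> (\<Gamma>(x \<mapsto> TMu A)) (Unfold y x) (\<Gamma>(y \<mapsto> unroll A))"
| proc: "\<lbrakk>f \<notin> dom \<Phi>; closed_ty A; closed_ty B; typed (\<Phi>(f \<mapsto> (A, B))) [x \<mapsto> A] M [y \<mapsto> B]\<rbrakk>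
    \<Longrightarrow> typed \<Phi> \<Gamma> (Proc f x A y B M) \<Gamma>"
| call: "\<lbrakk>\<Phi> f = Some (A, B); x \<notin> dom \<Gamma>; y \<notin> dom \<Gamma>\<rbrakk>
    \<Longrightarrow> typed \<Phi> (\<Gamma>(x \<mapsto> A)) (Call y f x) (\<Gamma>(y \<mapsto> B))"

lemma wf_lift_ty: "wf_ty n A \<Longrightarrow> k \<le> n \<Longrightarrow> wf_ty (Suc n) (lift_ty k A)"
  by (induction A arbitrary: n k) auto

lemma wf_subst_ty: "wf_ty (Suc n) A \<Longrightarrow> wf_ty n B \<Longrightarrow> k \<le> n \<Longrightarrow> wf_ty n (subst_ty A k B)"
  by (induction A arbitrary: n k B) (auto simp: wf_lift_ty)

lemma wf_var_ctx_upd: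
  "x \<notin> dom \<Gamma> \<Longrightarrow> wf_var_ctx (\<Gamma>(x \<mapsto> A)) \<longleftrightarrow> wf_var_ctx \<Gamma> \<and> closed_ty A"
  by (auto simp: wf_var_ctx_def domIff)

lemma typed_wf_var_ctx:
  "\<lbrakk>typed \<Phi> \<Gamma> M \<Sigma>; wf_proc_ctx \<Phi>; wf_var_ctx \<Gamma>\<rbrakk> \<Longrightarrow> wf_var_ctx \<Sigma>"
proof (induction rule: typed.induct)
  case (call \<Phi> f A B x \<Gamma> y)
  then have "closed_ty B"
    by (force simp: wf_proc_ctx_def ran_def)
  with call show ?case
    by (metis wf_var_ctx_upd)
qed (auto simp: wf_var_ctx_upd wf_subst_ty)


section \<open>Values\<close>

datatype val =
  VUnit | VPtr nat | VLeft ty ty val | VRight ty ty val | VPair val val | VFold ty val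

abbreviation VFalse :: val where
  "VFalse \<equiv> VLeft TUnit TUnit VUnit"

abbreviation VTrue :: val where
  "VTrue \<equiv> VRight TUnit TUnit VUnit"

inductive val_typed :: "nat set \<Rightarrow> val \<Rightarrow> ty \<Rightarrow> bool" where
  "val_typed {} VUnit TUnit"
| "val_typed {n} (VPtr n) TQbit"
| "val_typed Q v A \<Longrightarrow> val_typed Q (VLeft A B v) (TSum A B)"
| "val_typed Q v B \<Longrightarrow> val_typed Q (VRight A B v) (TSum A B)"
| "\<lbrakk>val_typed Q1 v A; val_typed Q2 w B; Q1 \<inter> Q2 = {}\<rbrakk>
    \<Longrightarrow> val_typed (Q1 \<union> Q2) (VPair v w) (TTensor A B)"
| "val_typed Q v (unroll A) \<Longrightarrow> val_typed Q (VFold A v) (TMu A)"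

type_synonym assignment = "var \<rightharpoonup> val"

definition assignment_typed :: "nat set \<Rightarrow> var_ctx \<Rightarrow> assignment \<Rightarrow> bool" where
  "assignment_typed Q \<Gamma> V \<longleftrightarrow> dom V = dom \<Gamma> \<and>
     (\<exists>Qs. disjoint_family_on Qs (dom \<Gamma>) \<and> Q = (\<Union>x \<in> dom \<Gamma>. Qs x) \<and>
           (\<forall>x \<in> dom \<Gamma>. val_typed (Qs x) (the (V x)) (the (\<Gamma> x))))"

primrec renumber_val :: "nat set \<Rightarrow> val \<Rightarrow> val" where
  "renumber_val Q VUnit = VUnit"
| "renumber_val Q (VPtr k) = VPtr (k - card {i \<in> Q. i < k})"
| "renumber_val Q (VLeft A B v) = VLeft A B (renumber_val Q v)"
| "renumber_val Q (VRight A B v) = VRight A B (renumber_val Q v)"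
| "renumber_val Q (VPair v w) = VPair (renumber_val Q v) (renumber_val Q w)"
| "renumber_val Q (VFold A v) = VFold A (renumber_val Q v)"

definition renumber :: "nat set \<Rightarrow> assignment \<Rightarrow> assignment" where
  "renumber Q V = map_option (renumber_val Q) \<circ> V"


section \<open>Configurations\<close>

text \<open>\<open>(f, x, A, y, B, M)\<close> is the definition \<open>f :: x : A \<rightarrow> y : B {M}\<close>.\<close>

type_synonym proc_def = "pname \<times> var \<times> ty \<times> var \<times> ty \<times> var trm"
type_synonym config = "var trm \<times> assignment \<times> proc_def set \<times> complex mat"

inductive store_typed :: "proc_ctx \<Rightarrow> proc_def set \<Rightarrow> bool" where
  "store_typed Map.empty {}"
| "\<lbrakk>store_typed \<Phi> \<Omega>; f \<notin> dom \<Phi>; closed_ty A; closed_ty B;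
    typed (\<Phi>(f \<mapsto> (A, B))) [x \<mapsto> A] M [y \<mapsto> B]\<rbrakk>
    \<Longrightarrow> store_typed (\<Phi>(f \<mapsto> (A, B))) (insert (f, x, A, y, B, M) \<Omega>)"

definition state_mat :: "complex mat \<Rightarrow> bool" where
  "state_mat \<rho> \<longleftrightarrow> (\<exists>n. \<rho> \<in> carrier_mat (2 ^ n) (2 ^ n)) \<and> psd_mat \<rho> \<and>
     mat_trace \<rho> \<in> complex_of_real ` {0..1}"

definition configuration :: "config \<Rightarrow> bool" where
  "configuration = (\<lambda>(M, V, \<Omega>, \<rho>). finite (dom V) \<and> finite \<Omega> \<and> state_mat \<rho>)"

definition wf_config ::
    "proc_ctx \<Rightarrow> var_ctx \<Rightarrow> var_ctx \<Rightarrow> nat set \<Rightarrow> config \<Rightarrow> bool" where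
  "wf_config \<Phi> \<Gamma> \<Sigma> Q C \<longleftrightarrow>
     wf_proc_ctx \<Phi> \<and> wf_var_ctx \<Gamma> \<and> wf_var_ctx \<Sigma> \<and> configuration C \<and>
     (case C of (M, V, \<Omega>, \<rho>) \<Rightarrow>
        typed \<Phi> \<Gamma> M \<Sigma> \<and> assignment_typed Q \<Gamma> V \<and> store_typed \<Phi> \<Omega> \<and> Q = {1..qubits \<rho>})"

definition terminal :: "config \<Rightarrow> bool" where
  "terminal C \<longleftrightarrow> fst C = Skip"

definition config_trace :: "config \<Rightarrow> complex" where
  "config_trace = (\<lambda>(M, V, \<Omega>, \<rho>). mat_trace \<rho>)"

definition config_vars :: "config \<Rightarrow> var set" where
  "config_vars = (\<lambda>(M, V, \<Omega>, \<rho>).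
     vars M \<union> dom V \<union> (\<Union>(f, x, A, y, B, N) \<in> \<Omega>. insert x (insert y (vars N))))"


section \<open>Reduction\<close>

definition if_then :: "var \<Rightarrow> var \<Rightarrow> var trm \<Rightarrow> var trm" where
  "if_then u b N =
     Case b u (InLeft TUnit TUnit b u) u (Seq (InRight TUnit TUnit b u) N)"

text \<open>
  \<open>r\<close> renames the body \<open>M\<close> of a procedure with formal variables \<open>x2\<close>, \<open>y2\<close> for a call with actual
  variables \<open>x1\<close>, \<open>y1\<close>, all other variables getting distinct names outside \<open>X\<close>. A procedure may
  use one variable for both input and output; then that variable is renamed to \<open>x1\<close>.
\<close>

definition call_renaming ::
    "var set \<Rightarrow> var \<Rightarrow> var \<Rightarrow> var \<Rightarrow> var \<Rightarrow> var trm \<Rightarrow> (var \<Rightarrow> var) \<Rightarrow> bool" where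
  "call_renaming X x1 y1 x2 y2 M r \<longleftrightarrow>
     r x2 = x1 \<and> (y2 \<noteq> x2 \<longrightarrow> r y2 = y1) \<and>
     inj_on r (vars M - {x2, y2}) \<and> r ` (vars M - {x2, y2}) \<inter> X = {}"

text \<open>\<open>X\<close> is the set of names that fresh names have to avoid. It is passed unchanged through
  \<open>seq2\<close>, so that names are fresh for the whole configuration and not just for its active part.\<close>

inductive step :: "var set \<Rightarrow> config \<Rightarrow> config \<Rightarrow> bool" for X :: "var set" where
  unit: "u \<notin> dom V \<Longrightarrow> step X (NewUnit u, V, \<Omega>, \<rho>) (Skip, V(u \<mapsto> VUnit), \<Omega>, \<rho>)"
| discard: "\<lbrakk>x \<notin> dom V; val_typed Q v A\<rbrakk>
    \<Longrightarrow> step X (Discard x, V(x \<mapsto> v), \<Omega>, \<rho>) (Skip, renumber Q V, \<Omega>, partial_trace Q \<rho>)"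
| copy: "\<lbrakk>x \<notin> dom V; y \<notin> dom V; x \<noteq> y\<rbrakk>
    \<Longrightarrow> step X (Copy y x, V(x \<mapsto> v), \<Omega>, \<rho>) (Skip, V(x \<mapsto> v, y \<mapsto> v), \<Omega>, \<rho>)"
| qbit: "q \<notin> dom V
    \<Longrightarrow> step X (NewQbit q, V, \<Omega>, \<rho>)
          (Skip, V(q \<mapsto> VPtr (qubits \<rho> + 1)), \<Omega>, kron \<rho> (ket 0 * mat_adjoint (ket 0)))"
| unitary: "\<lbrakk>length qs = arity S; length ms = length qs; distinct qs; set qs \<inter> dom V = {};
      V' = V(qs [\<mapsto>] map VPtr ms)\<rbrakk>
    \<Longrightarrow> step X (Apply qs S, V', \<Omega>, \<rho>) (Skip, V', \<Omega>, apply_gate ms (gate_mat S) \<rho>)"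
| measure0: "\<lbrakk>q \<notin> dom V; b \<notin> dom V\<rbrakk>
    \<Longrightarrow> step X (Measure b q, V(q \<mapsto> VPtr m), \<Omega>, \<rho>)
          (Skip, (renumber {m} V)(b \<mapsto> VFalse), \<Omega>, measure_branch m 0 \<rho>)"
| measure1: "\<lbrakk>q \<notin> dom V; b \<notin> dom V\<rbrakk>
    \<Longrightarrow> step X (Measure b q, V(q \<mapsto> VPtr m), \<Omega>, \<rho>)
          (Skip, (renumber {m} V)(b \<mapsto> VTrue), \<Omega>, measure_branch m 1 \<rho>)"
| seq1: "step X (Seq Skip N, V, \<Omega>, \<rho>) (N, V, \<Omega>, \<rho>)"
| seq2: "step X (M, V, \<Omega>, \<rho>) (M', V', \<Omega>', \<rho>')
    \<Longrightarrow> step X (Seq M N, V, \<Omega>, \<rho>) (Seq M' N, V', \<Omega>', \<rho>')"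
| while: "\<lbrakk>b \<notin> dom V; u \<notin> X\<rbrakk>
    \<Longrightarrow> step X (While b M, V(b \<mapsto> v), \<Omega>, \<rho>)
          (if_then u b (Seq M (While b M)), V(b \<mapsto> v), \<Omega>, \<rho>)"
| left: "\<lbrakk>x \<notin> dom V; y \<notin> dom V\<rbrakk>
    \<Longrightarrow> step X (InLeft A B y x, V(x \<mapsto> v), \<Omega>, \<rho>) (Skip, V(y \<mapsto> VLeft A B v), \<Omega>, \<rho>)"
| right: "\<lbrakk>x \<notin> dom V; y \<notin> dom V\<rbrakk>
    \<Longrightarrow> step X (InRight A B y x, V(x \<mapsto> v), \<Omega>, \<rho>) (Skip, V(y \<mapsto> VRight A B v), \<Omega>, \<rho>)"
| case_left: "\<lbrakk>y \<notin> dom V; x1 \<notin> dom V\<rbrakk>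
    \<Longrightarrow> step X (Case y x1 M1 x2 M2, V(y \<mapsto> VLeft A B v), \<Omega>, \<rho>) (M1, V(x1 \<mapsto> v), \<Omega>, \<rho>)"
| case_right: "\<lbrakk>y \<notin> dom V; x2 \<notin> dom V\<rbrakk>
    \<Longrightarrow> step X (Case y x1 M1 x2 M2, V(y \<mapsto> VRight A B v), \<Omega>, \<rho>) (M2, V(x2 \<mapsto> v), \<Omega>, \<rho>)"
| pair: "\<lbrakk>x1 \<notin> dom V; x2 \<notin> dom V; x1 \<noteq> x2; x \<notin> dom V\<rbrakk>
    \<Longrightarrow> step X (Pair x x1 x2, V(x1 \<mapsto> v1, x2 \<mapsto> v2), \<Omega>, \<rho>) (Skip, V(x \<mapsto> VPair v1 v2), \<Omega>, \<rho>)"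
| unpair: "\<lbrakk>x1 \<notin> dom V; x2 \<notin> dom V; x1 \<noteq> x2; x \<notin> dom V\<rbrakk>
    \<Longrightarrow> step X (Unpair x1 x2 x, V(x \<mapsto> VPair v1 v2), \<Omega>, \<rho>) (Skip, V(x1 \<mapsto> v1, x2 \<mapsto> v2), \<Omega>, \<rho>)"
| fold: "\<lbrakk>x \<notin> dom V; y \<notin> dom V\<rbrakk>
    \<Longrightarrow> step X (Fold A y x, V(x \<mapsto> v), \<Omega>, \<rho>) (Skip, V(y \<mapsto> VFold A v), \<Omega>, \<rho>)"
| unfold: "\<lbrakk>x \<notin> dom V; y \<notin> dom V\<rbrakk>
    \<Longrightarrow> step X (Unfold y x, V(x \<mapsto> VFold A v), \<Omega>, \<rho>) (Skip, V(y \<mapsto> v), \<Omega>, \<rho>)"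
| proc: "step X (Proc f x A y B M, V, \<Omega>, \<rho>) (Skip, V, insert (f, x, A, y, B, M) \<Omega>, \<rho>)"
| call: "\<lbrakk>x1 \<notin> dom V; (f, x2, A, y2, B, M) \<in> \<Omega>; call_renaming X x1 y1 x2 y2 M r\<rbrakk>
    \<Longrightarrow> step X (Call y1 f x1, V(x1 \<mapsto> v), \<Omega>, \<rho>) (rename r M, V(x1 \<mapsto> v), \<Omega>, \<rho>)"

definition reduces :: "config \<Rightarrow> config \<Rightarrow> bool" (infix \<open>\<leadsto>\<close> 50) where
  "C \<leadsto> D \<longleftrightarrow> configuration C \<and> configuration D \<and> step (config_vars C) C D"

text \<open>
  Configurations reached from \<open>C\<close> that differ only in the choice of fresh names: they are related by
  a permutation of the names that do not occur in \<open>C\<close>. Fresh names are introduced in the term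
  component only, so the permutation acts on that component.
\<close>

definition same_upto_fresh :: "config \<Rightarrow> (config \<times> config) set" where
  "same_upto_fresh C = {((M, V, \<Omega>, \<rho>), (M', V', \<Omega>', \<rho>')).
     (\<exists>\<pi>. bij \<pi> \<and> (\<forall>x \<in> config_vars C. \<pi> x = x) \<and> M' = rename \<pi> M) \<and>
     V' = V \<and> \<Omega>' = \<Omega> \<and> \<rho>' = \<rho>}"

definition reducts :: "config \<Rightarrow> config set set" where
  "reducts C = {D. C \<leadsto> D} // same_upto_fresh C"

lemma equiv_same_upto_fresh: "equiv UNIV (same_upto_fresh C)"
proof (rule equivI)
  show "refl (same_upto_fresh C)"
    by (auto simp: refl_on_def same_upto_fresh_def trm.map_id0 intro!: exI[of _ id])
  show "sym (same_upto_fresh C)"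
  proof (rule symI, clarsimp simp: same_upto_fresh_def)
    fix \<pi> and M :: "var trm"
    assume "bij \<pi>" and fixed: "\<forall>x \<in> config_vars C. \<pi> x = x"
    then have "inv_into UNIV \<pi> \<circ> \<pi> = id"
      by (simp add: bij_is_inj)
    then have "M = rename (inv_into UNIV \<pi>) (rename \<pi> M)"
      by (simp add: trm.map_comp trm.map_id0)
    moreover have "\<forall>x \<in> config_vars C. inv_into UNIV \<pi> x = x"
      using \<open>bij \<pi>\<close> fixed by (metis bij_is_inj inv_f_f)
    ultimately show "\<exists>\<pi>'. bij \<pi>' \<and> (\<forall>x \<in> config_vars C. \<pi>' x = x) \<and> M = rename \<pi>' (rename \<pi> M)"
      using \<open>bij \<pi>\<close> bij_imp_bij_inv by blast
  qed
  show "trans (same_upto_fresh C)"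
  proof (rule transI, clarsimp simp: same_upto_fresh_def)
    fix \<pi> \<pi>' and M :: "var trm"
    assume "bij \<pi>" "bij \<pi>'"
      "\<forall>x \<in> config_vars C. \<pi> x = x" "\<forall>x \<in> config_vars C. \<pi>' x = x"
    then show "\<exists>\<pi>''. bij \<pi>'' \<and> (\<forall>x \<in> config_vars C. \<pi>'' x = x) \<and>
        rename \<pi>' (rename \<pi> M) = rename \<pi>'' M"
      by (intro exI[of _ "\<pi>' \<circ> \<pi>"]) (auto simp: trm.map_comp bij_comp)
  qed
qed simp

end

theory Submission
  imports Defs
begin

text \<open>
  A non-terminal well-formed configuration steps according to the head command of its term. The typing
  of the assignment provides a value of the right shape for every variable that is consumed, and it
  places the pointers of distinct variables at distinct qubits of the state, so the rule for that
  command applies. Only the measurement rules overlap; the two reducts are told apart by the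
  value of the measured bit. All other nondeterminism is the choice of fresh names, and any two choices
  are related by a permutation of the names that do not occur in the configuration.

  On states, every rule acts by maps \<open>\<rho> \<mapsto> \<Sum>\<^sub>i K\<^sub>i \<rho> K\<^sub>i\<^sup>\<dagger>\<close> with \<open>\<Sum>\<^sub>i K\<^sub>i\<^sup>\<dagger> K\<^sub>i = 1\<close>,
  possibly with one reduct per summand. Cyclicity of the trace then makes the traces of the reducts
  add up to \<open>tr \<rho>\<close>.
\<close>

section \<open>Positive semidefinite matrices and traces\<close>

lemma mat_adjoint_dim [simp]:
  "dim_row (mat_adjoint A) = dim_col A" "dim_col (mat_adjoint A) = dim_row A"
  by (simp_all add: mat_adjoint_def mat_of_rows_def)

lemma mat_adjoint_index [simp]:
  "i < dim_col A \<Longrightarrow> j < dim_row A \<Longrightarrow> mat_adjoint A $$ (i, j) = conjugate (A $$ (j, i))"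
  by (simp add: mat_adjoint_def mat_of_rows_def)

lemma mat_adjoint_carrier [simp]:
  "A \<in> carrier_mat n m \<Longrightarrow> mat_adjoint A \<in> carrier_mat m n"
  by (intro carrier_matI) auto

lemma mat_adjoint_adjoint [simp]: "mat_adjoint (mat_adjoint A) = A"
  by (rule eq_matI) auto

lemma mat_adjoint_one [simp]: "mat_adjoint (1\<^sub>m n :: complex mat) = 1\<^sub>m n"
  by (rule eq_matI) auto

lemma mat_adjoint_mult:
  fixes A B :: "complex mat"
  assumes "A \<in> carrier_mat n m" "B \<in> carrier_mat m k"
  shows "mat_adjoint (A * B) = mat_adjoint B * mat_adjoint A"
  using assms by (intro eq_matI) (auto simp: scalar_prod_def mult.commute)

lemma mat_adjoint_add:
  fixes A B :: "complex mat"
  assumes "A \<in> carrier_mat n m" "B \<in> carrier_mat n m"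
  shows "mat_adjoint (A + B) = mat_adjoint A + mat_adjoint B"
  using assms by (intro eq_matI) auto

lemma mat_trace_comm:
  assumes "A \<in> carrier_mat n m" "B \<in> carrier_mat m n"
  shows "mat_trace (A * B) = mat_trace (B * A)"
proof -
  have "mat_trace (A * B) = (\<Sum>i<n. \<Sum>j<m. A $$ (i, j) * B $$ (j, i))"
    using assms by (simp add: mat_trace_def scalar_prod_def atLeast0LessThan)
  also have "\<dots> = (\<Sum>j<m. \<Sum>i<n. B $$ (j, i) * A $$ (i, j))"
    by (subst sum.swap) (simp add: mult.commute)
  also have "\<dots> = mat_trace (B * A)"
    using assms by (simp add: mat_trace_def scalar_prod_def atLeast0LessThan)
  finally show ?thesis .
qed

lemma mat_trace_add:
  assumes "A \<in> carrier_mat n n" "B \<in> carrier_mat n n"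
  shows "mat_trace (A + B) = mat_trace A + mat_trace B"
  using assms by (simp add: mat_trace_def sum.distrib)

lemma mult_mat_vec_cscalar_prod:
  fixes A :: "complex mat"
  assumes "A \<in> carrier_mat n m" "v \<in> carrier_vec m" "w \<in> carrier_vec n"
  shows "(A *\<^sub>v v) \<bullet>c w = v \<bullet>c (mat_adjoint A *\<^sub>v w)"
proof -
  have "(A *\<^sub>v v) \<bullet>c w = (\<Sum>i<n. \<Sum>j<m. A $$ (i, j) * v $ j * cnj (w $ i))"
    using assms by (simp add: scalar_prod_def atLeast0LessThan sum_distrib_right)
  also have "\<dots> = (\<Sum>j<m. \<Sum>i<n. v $ j * cnj (cnj (A $$ (i, j)) * w $ i))"
    by (subst sum.swap) (simp add: mult_ac)
  also have "\<dots> = v \<bullet>c (mat_adjoint A *\<^sub>v w)"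
    using assms by (simp add: scalar_prod_def atLeast0LessThan sum_distrib_left)
  finally show ?thesis .
qed

text \<open>The quadratic form of the conjugate at \<open>v\<close> is that of \<open>\<rho>\<close>
  at \<open>K *\<^sub>v v\<close>. Rectangular \<open>K\<close> are allowed because measuring a
  qubit lowers the dimension and a new qubit raises it.\<close>

lemma psd_mat_conj:
  fixes \<rho> K :: "complex mat"
  assumes "psd_mat \<rho>" "\<rho> \<in> carrier_mat n n" and K: "K \<in> carrier_mat n m"
  shows "psd_mat (mat_adjoint K * \<rho> * K)"
proof -
  have \<rho>: "\<rho> \<in> carrier_mat n n" and "mat_adjoint \<rho> = \<rho>"
    and pos: "\<And>v. v \<in> carrier_vec n \<Longrightarrow> 0 \<le> Re ((\<rho> *\<^sub>v v) \<bullet>c v)"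
    using assms by (auto simp: psd_mat_def)
  have K': "mat_adjoint K \<in> carrier_mat m n"
    using K by simp
  have "mat_adjoint (mat_adjoint K * \<rho> * K) = mat_adjoint K * (\<rho> * K)"
    using K K' \<rho> \<open>mat_adjoint \<rho> = \<rho>\<close>
    by (simp add: mat_adjoint_mult[OF mult_carrier_mat[OF K' \<rho>] K] mat_adjoint_mult[OF K' \<rho>])
  also have "\<dots> = mat_adjoint K * \<rho> * K"
    by (rule assoc_mult_mat[symmetric, OF K' \<rho> K])
  finally have "mat_adjoint (mat_adjoint K * \<rho> * K) = mat_adjoint K * \<rho> * K" .
  moreover have "0 \<le> Re ((mat_adjoint K * \<rho> * K *\<^sub>v v) \<bullet>c v)" if v: "v \<in> carrier_vec m" for v
  proof -
    have "mat_adjoint K * \<rho> * K *\<^sub>v v = mat_adjoint K *\<^sub>v (\<rho> *\<^sub>v (K *\<^sub>v v))"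
      using K v
      by (simp only: assoc_mult_mat_vec[OF mult_carrier_mat[OF K' \<rho>] K v]
          assoc_mult_mat_vec[OF K' \<rho>] mult_mat_vec_carrier)
    moreover have "(mat_adjoint K *\<^sub>v (\<rho> *\<^sub>v (K *\<^sub>v v))) \<bullet>c v = (\<rho> *\<^sub>v (K *\<^sub>v v)) \<bullet>c (K *\<^sub>v v)"
      using K \<rho> v mult_mat_vec_cscalar_prod[OF K', of "\<rho> *\<^sub>v (K *\<^sub>v v)" v] by simp
    ultimately have "(mat_adjoint K * \<rho> * K *\<^sub>v v) \<bullet>c v = (\<rho> *\<^sub>v (K *\<^sub>v v)) \<bullet>c (K *\<^sub>v v)"
      by (simp only:)
    then show ?thesis
      using K v pos by simp
  qed
  ultimately show ?thesis
    using K by (simp add: psd_mat_def)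
qed

lemma psd_mat_add:
  assumes "psd_mat A" "psd_mat B" "A \<in> carrier_mat n n" "B \<in> carrier_mat n n"
  shows "psd_mat (A + B)"
  using assms
  by (auto simp: psd_mat_def mat_adjoint_add[of _ n n] add_mult_distrib_mat_vec[of _ n n]
      add_scalar_prod_distrib[of _ n])

text \<open>The diagonal entry is the quadratic form at the \<open>i\<close>-th unit vector, and
  Hermitian symmetry makes it real.\<close>

lemma psd_mat_diag:
  assumes "psd_mat A" "A \<in> carrier_mat n n" "i < n"
  shows "0 \<le> Re (A $$ (i, i))" "Im (A $$ (i, i)) = 0"
proof -
  have "conjugate (unit_vec n i) = (unit_vec n i :: complex vec)"
    by (rule eq_vecI) (auto simp: unit_vec_def)
  then have "(A *\<^sub>v unit_vec n i) \<bullet>c unit_vec n i = A $$ (i, i)"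
    using assms(2,3) by (simp add: scalar_prod_right_unit[of i n])
  moreover have "dim_row A = n" and adj: "mat_adjoint A = A"
    using assms(1,2) by (auto simp: psd_mat_def)
  ultimately show "0 \<le> Re (A $$ (i, i))"
    using assms(1) by (metis psd_mat_def unit_vec_carrier)
  have "A $$ (i, i) = cnj (A $$ (i, i))"
    using adj assms(2,3) mat_adjoint_index[of i A i] by simp
  then show "Im (A $$ (i, i)) = 0"
    by (metis Reals_cnj_iff complex_is_Real_iff)
qed

lemma psd_mat_trace:
  assumes "psd_mat A"
  shows "0 \<le> Re (mat_trace A)" "Im (mat_trace A) = 0"
proof -
  obtain n where "A \<in> carrier_mat n n"
    using assms by (auto simp: psd_mat_def)
  with psd_mat_diag[OF assms this] show "0 \<le> Re (mat_trace A)" "Im (mat_trace A) = 0"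
    by (auto simp: mat_trace_def intro!: sum_nonneg)
qed

section \<open>States and conjugation by isometries\<close>

lemma state_mat_iff:
  "state_mat \<rho> \<longleftrightarrow> (\<exists>n. \<rho> \<in> carrier_mat (2 ^ n) (2 ^ n)) \<and> psd_mat \<rho> \<and> Re (mat_trace \<rho>) \<le> 1"
proof -
  \<comment> \<open>Positive semidefiniteness already makes the trace real and nonnegative, so only
    the upper bound remains to be checked.\<close>
  have "mat_trace \<rho> \<in> complex_of_real ` {0..1} \<longleftrightarrow> Re (mat_trace \<rho>) \<le> 1" if "psd_mat \<rho>"
    using psd_mat_trace[OF that]
    by (auto simp: image_iff complex_eq_iff)
  then show ?thesis
    by (auto simp: state_mat_def)
qed

lemma qubits_eq: "A \<in> carrier_mat (2 ^ n) m \<Longrightarrow> qubits A = n"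
  by (auto simp: qubits_def)

lemma state_mat_carrier:
  "state_mat \<rho> \<Longrightarrow> \<rho> \<in> carrier_mat (2 ^ qubits \<rho>) (2 ^ qubits \<rho>)"
  by (auto simp: state_mat_def qubits_eq)

text \<open>Cyclicity turns the trace into that of \<open>mat_adjoint U * U * \<rho>\<close>, where
  the isometry condition removes \<open>U\<close>. Since \<open>U\<close> may be rectangular, gates
  and the addition of a qubit are both covered.\<close>

lemma state_mat_isometry:
  assumes "state_mat \<rho>" and U: "U \<in> carrier_mat (2 ^ m) (2 ^ qubits \<rho>)"
    and iso: "mat_adjoint U * U = 1\<^sub>m (2 ^ qubits \<rho>)"
  shows "state_mat (U * \<rho> * mat_adjoint U)" "mat_trace (U * \<rho> * mat_adjoint U) = mat_trace \<rho>"
proof -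
  have \<rho>: "\<rho> \<in> carrier_mat (2 ^ qubits \<rho>) (2 ^ qubits \<rho>)"
    by (rule state_mat_carrier) fact
  note U' = mat_adjoint_carrier[OF U]
  have "mat_trace (U * \<rho> * mat_adjoint U) = mat_trace (mat_adjoint U * (U * \<rho>))"
    by (rule mat_trace_comm[OF mult_carrier_mat[OF U \<rho>] U'])
  also have "\<dots> = mat_trace (mat_adjoint U * U * \<rho>)"
    using assoc_mult_mat[OF U' U \<rho>] by simp
  also have "\<dots> = mat_trace \<rho>"
    by (simp only: iso left_mult_one_mat[OF \<rho>])
  finally show tr: "mat_trace (U * \<rho> * mat_adjoint U) = mat_trace \<rho>" .
  show "state_mat (U * \<rho> * mat_adjoint U)"
    using psd_mat_conj[OF _ \<rho> U'] assms(1) tr mult_carrier_mat[OF mult_carrier_mat[OF U \<rho>] U']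
    by (auto simp: state_mat_iff)
qed

section \<open>Kronecker products, measurement and partial trace\<close>

text \<open>A Kronecker index \<open>k\<close> stands for the pair of its quotient and remainder by
  \<open>n\<close>; the sum is cut into blocks of length \<open>n\<close>, one for each
  quotient.\<close>

lemma sum_divmod:
  fixes m n :: nat
  shows "(\<Sum>k<m * n. f (k div n) (k mod n)) = (\<Sum>i<m. \<Sum>j<n. f i j)"
proof -
  have "(\<Sum>i<m. \<Sum>j<n. f i j) = (\<Sum>i<m. \<Sum>k\<in>{i * n..<i * n + n}. f (k div n) (k mod n))"
  proof (rule sum.cong[OF refl])
    fix i
    show "(\<Sum>j<n. f i j) = (\<Sum>k\<in>{i * n..<i * n + n}. f (k div n) (k mod n))"
      by (rule sum.reindex_bij_witness[of _ "\<lambda>k. k - i * n" "\<lambda>j. i * n + j"])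
        (auto simp: add.commute)
  qed
  then show ?thesis
    by (simp add: sum.nat_group)
qed

lemma kron_dim [simp]:
  "dim_row (kron A B) = dim_row A * dim_row B" "dim_col (kron A B) = dim_col A * dim_col B"
  by (simp_all add: kron_def)

lemma kron_carrier [simp]:
  "A \<in> carrier_mat n m \<Longrightarrow> B \<in> carrier_mat n' m' \<Longrightarrow> kron A B \<in> carrier_mat (n * n') (m * m')"
  by (intro carrier_matI) auto

lemma kron_index:
  "i < dim_row A * dim_row B \<Longrightarrow> j < dim_col A * dim_col B \<Longrightarrow>
    kron A B $$ (i, j) =
      A $$ (i div dim_row B, j div dim_col B) * B $$ (i mod dim_row B, j mod dim_col B)"
  by (simp add: kron_def)

lemma div_mod_less_mult:
  fixes i m n :: nat
  assumes "i < m * n"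
  shows "i div n < m" "i mod n < n" "0 < n"
proof -
  show "0 < n"
    using assms by (cases n) auto
  then show "i div n < m" "i mod n < n"
    using assms by (auto simp: less_mult_imp_div_less)
qed

text \<open>Mixed-product rule: once the inner index is split into quotient and remainder, the
  double sum factors into entries of the two smaller products.\<close>

lemma kron_mult:
  assumes "A \<in> carrier_mat n m" "C \<in> carrier_mat m k" "B \<in> carrier_mat n' m'" "D \<in> carrier_mat m' k'"
  shows "kron A B * kron C D = kron (A * C) (B * D)"
proof (rule eq_matI)
  fix i j
  assume ij: "i < dim_row (kron (A * C) (B * D))" "j < dim_col (kron (A * C) (B * D))"
  then have i: "i < n * n'" and j: "j < k * k'"
    using assms by auto
  note bounds = div_mod_less_mult[OF i] div_mod_less_mult[OF j]
  have "(kron A B * kron C D) $$ (i, j) = (\<Sum>l<m * m'. kron A B $$ (i, l) * kron C D $$ (l, j))"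
    using assms i j by (simp add: scalar_prod_def atLeast0LessThan)
  also have "\<dots> = (\<Sum>l<m * m'. A $$ (i div n', l div m') * B $$ (i mod n', l mod m') *
      (C $$ (l div m', j div k') * D $$ (l mod m', j mod k')))"
    using assms i j by (intro sum.cong refl) (simp add: kron_index)
  also have "\<dots> = (\<Sum>a<m. \<Sum>b<m'. A $$ (i div n', a) * B $$ (i mod n', b) *
      (C $$ (a, j div k') * D $$ (b, j mod k')))"
    by (rule sum_divmod[of "\<lambda>a b. A $$ (i div n', a) * B $$ (i mod n', b) *
      (C $$ (a, j div k') * D $$ (b, j mod k'))"])
  also have "\<dots> = (\<Sum>a<m. A $$ (i div n', a) * C $$ (a, j div k')) *
      (\<Sum>b<m'. B $$ (i mod n', b) * D $$ (b, j mod k'))"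
    by (simp add: sum_product mult_ac)
  also have "\<dots> = kron (A * C) (B * D) $$ (i, j)"
    using assms i j bounds by (simp add: kron_index scalar_prod_def atLeast0LessThan)
  finally show "(kron A B * kron C D) $$ (i, j) = kron (A * C) (B * D) $$ (i, j)" .
qed (use assms in auto)

lemma kron_adjoint: "mat_adjoint (kron A B) = kron (mat_adjoint A) (mat_adjoint B)"
  for A B :: "complex mat"
proof (rule eq_matI)
  fix i j
  assume "i < dim_row (kron (mat_adjoint A) (mat_adjoint B))"
    "j < dim_col (kron (mat_adjoint A) (mat_adjoint B))"
  then have "i < dim_col A * dim_col B" "j < dim_row A * dim_row B"
    by auto
  from this this[THEN div_mod_less_mult(1)] this[THEN div_mod_less_mult(2)]
  show "mat_adjoint (kron A B) $$ (i, j) = kron (mat_adjoint A) (mat_adjoint B) $$ (i, j)"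
    by (simp add: kron_index)
qed auto

lemma kron_one: "kron (1\<^sub>m m) (1\<^sub>m n) = 1\<^sub>m (m * n)"
proof (rule eq_matI)
  fix i j
  assume "i < dim_row (1\<^sub>m (m * n) :: complex mat)" "j < dim_col (1\<^sub>m (m * n) :: complex mat)"
  then have "i < m * n" "j < m * n"
    by auto
  moreover have "i div n = j div n \<and> i mod n = j mod n \<longleftrightarrow> i = j"
    by (metis div_mult_mod_eq)
  ultimately show "kron (1\<^sub>m m) (1\<^sub>m n) $$ (i, j) = (1\<^sub>m (m * n) :: complex mat) $$ (i, j)"
    using div_mod_less_mult[of i m n] div_mod_less_mult[of j m n] by (auto simp: kron_index)
qed auto

lemma kron_one_right: "kron A (1\<^sub>m 1) = A"
  by (rule eq_matI) (auto simp: kron_index)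

lemma kron_add_left:
  assumes "A \<in> carrier_mat n m" "B \<in> carrier_mat n m"
  shows "kron A C + kron B C = kron (A + B) C"
proof (rule eq_matI)
  fix i j
  assume "i < dim_row (kron (A + B) C)" "j < dim_col (kron (A + B) C)"
  then have "i < dim_row B * dim_row C" "j < dim_col B * dim_col C"
    by auto
  from this this[THEN div_mod_less_mult(1)] this[THEN div_mod_less_mult(2)]
  show "(kron A C + kron B C) $$ (i, j) = kron (A + B) C $$ (i, j)"
    using assms by (simp add: kron_index algebra_simps)
qed (use assms in auto)

lemma kron_add_right:
  assumes "A \<in> carrier_mat n m" "B \<in> carrier_mat n m"
  shows "kron C A + kron C B = kron C (A + B)"
proof (rule eq_matI)
  fix i j
  assume "i < dim_row (kron C (A + B))" "j < dim_col (kron C (A + B))"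
  then have "i < dim_row C * dim_row B" "j < dim_col C * dim_col B"
    by auto
  from this this[THEN div_mod_less_mult(1)] this[THEN div_mod_less_mult(2)]
  show "(kron C A + kron C B) $$ (i, j) = kron C (A + B) $$ (i, j)"
    using assms by (simp add: kron_index algebra_simps)
qed (use assms in auto)

section \<open>Kets, completeness and measurement\<close>

lemma ket_carrier [simp]: "ket i \<in> carrier_mat 2 1"
  by (simp add: ket_def)

lemma ket_adjoint_ket: "i < 2 \<Longrightarrow> mat_adjoint (ket i) * ket i = 1\<^sub>m 1"
  by (rule eq_matI) (auto simp: ket_def scalar_prod_def if_distrib cong: if_cong)

lemma ket_completeness: "ket 0 * mat_adjoint (ket 0) + ket 1 * mat_adjoint (ket 1) = 1\<^sub>m 2"
  by (rule eq_matI) (auto simp: ket_def scalar_prod_def less_2_cases_iff)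

context
  fixes N m :: nat
  assumes m: "m \<in> {1..N}"
begin

text \<open>Dimension count for the three Kronecker factors of \<open>ket_at\<close>, the middle one
  having 2 rows and 1 column. The factor 1 is kept so that the terms match those produced by
  \<open>kron_carrier\<close>.\<close>

lemma two_power_split:
  "2 ^ (m - 1) * 2 * 2 ^ (N - m) = (2 ^ N :: nat)"
  "2 ^ (m - 1) * 1 * 2 ^ (N - m) = (2 ^ (N - 1) :: nat)"
  using m by (auto simp flip: power_add power_Suc2)

lemma ket_at_carrier: "ket_at N m i \<in> carrier_mat (2 ^ N) (2 ^ (N - 1))"
proof -
  have "ket_at N m i \<in>
      carrier_mat (2 ^ (m - 1) * 2 * 2 ^ (N - m)) (2 ^ (m - 1) * 1 * 2 ^ (N - m))"
    unfolding ket_at_def by (intro kron_carrier ket_carrier one_carrier_mat)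
  then show ?thesis
    by (simp only: two_power_split)
qed

text \<open>By the mixed-product rule each summand is the projection onto one value of qubit
  \<open>m\<close>, with identities on both sides. Linearity in the middle factor reduces the claim
  to \<open>ket_completeness\<close>.\<close>

lemma ket_at_completeness:
  "ket_at N m 0 * mat_adjoint (ket_at N m 0) + ket_at N m 1 * mat_adjoint (ket_at N m 1) =
    1\<^sub>m (2 ^ N)"
proof -
  let ?l = "2 ^ (m - 1)" and ?r = "2 ^ (N - m)"
  have proj: "ket_at N m i * mat_adjoint (ket_at N m i) =
      kron (kron (1\<^sub>m ?l) (ket i * mat_adjoint (ket i))) (1\<^sub>m ?r)" for i
    using kron_mult[OF kron_carrier[OF one_carrier_mat ket_carrier] kron_carrier[OF one_carrier_mat mat_adjoint_carrier[OF ket_carrier]]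
        one_carrier_mat one_carrier_mat]
      kron_mult[OF one_carrier_mat one_carrier_mat ket_carrier mat_adjoint_carrier[OF ket_carrier]]
    unfolding ket_at_def kron_adjoint mat_adjoint_one by simp
  have K: "ket i * mat_adjoint (ket i) \<in> carrier_mat 2 2" for i
    by (rule mult_carrier_mat[OF ket_carrier mat_adjoint_carrier[OF ket_carrier]])
  show ?thesis
    unfolding proj
    using kron_carrier[OF one_carrier_mat[of ?l] K]
    by (subst kron_add_left[of _ "?l * 2" "?l * 2"], simp, simp, subst kron_add_right[OF K K])
      (simp only: ket_completeness kron_one two_power_split)
qed

end

text \<open>The trace of branch \<open>i\<close> is that of \<open>\<rho>\<close> multiplied by the
  projection of qubit \<open>m\<close> onto \<open>i\<close>, so completeness yields the sum. Both
  branch traces are nonnegative, hence neither exceeds the trace of \<open>\<rho>\<close>.\<close>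

lemma state_mat_measure_branch:
  assumes "state_mat \<rho>" and m: "m \<in> {1..qubits \<rho>}"
  shows "state_mat (measure_branch m 0 \<rho>)" "state_mat (measure_branch m 1 \<rho>)"
    "measure_branch m i \<rho> \<in> carrier_mat (2 ^ (qubits \<rho> - 1)) (2 ^ (qubits \<rho> - 1))"
    "mat_trace (measure_branch m 0 \<rho>) + mat_trace (measure_branch m 1 \<rho>) = mat_trace \<rho>"
proof -
  let ?N = "qubits \<rho>" and ?K = "\<lambda>i. ket_at (qubits \<rho>) m i"
  have \<rho>: "\<rho> \<in> carrier_mat (2 ^ ?N) (2 ^ ?N)"
    by (rule state_mat_carrier) fact
  note K = ket_at_carrier[OF m] and K' = mat_adjoint_carrier[OF ket_at_carrier[OF m]]
  show C: "measure_branch m i \<rho> \<in> carrier_mat (2 ^ (qubits \<rho> - 1)) (2 ^ (qubits \<rho> - 1))" for i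
    unfolding measure_branch_def by (intro mult_carrier_mat[OF mult_carrier_mat[OF K' \<rho>] K])
  have P: "psd_mat (measure_branch m i \<rho>)" for i
    unfolding measure_branch_def using assms by (intro psd_mat_conj[OF _ \<rho> K]) (simp add: state_mat_iff)
  have KK: "?K i * mat_adjoint (?K i) \<in> carrier_mat (2 ^ ?N) (2 ^ ?N)" for i
    by (intro mult_carrier_mat[OF K K'])
  have "mat_trace (measure_branch m i \<rho>) = mat_trace (?K i * mat_adjoint (?K i) * \<rho>)" for i
  proof -
    have "mat_trace (measure_branch m i \<rho>) = mat_trace (?K i * (mat_adjoint (?K i) * \<rho>))"
      unfolding measure_branch_def by (rule mat_trace_comm[OF mult_carrier_mat[OF K' \<rho>] K])
    then show ?thesis
      by (simp add: assoc_mult_mat[OF K K' \<rho>])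
  qed
  then have "mat_trace (measure_branch m 0 \<rho>) + mat_trace (measure_branch m 1 \<rho>) =
      mat_trace ((?K 0 * mat_adjoint (?K 0) + ?K 1 * mat_adjoint (?K 1)) * \<rho>)"
    by (simp only: add_mult_distrib_mat[OF KK KK \<rho>]
        mat_trace_add[OF mult_carrier_mat[OF KK \<rho>] mult_carrier_mat[OF KK \<rho>]])
  also have "\<dots> = mat_trace \<rho>"
    using \<rho> by (simp only: ket_at_completeness[OF m] left_mult_one_mat)
  finally show T: "mat_trace (measure_branch m 0 \<rho>) + mat_trace (measure_branch m 1 \<rho>) = mat_trace \<rho>" .
  have "Re (mat_trace (measure_branch m 0 \<rho>)) + Re (mat_trace (measure_branch m 1 \<rho>)) = Re (mat_trace \<rho>)"
    by (simp flip: T)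
  then have "Re (mat_trace (measure_branch m 0 \<rho>)) \<le> 1" "Re (mat_trace (measure_branch m 1 \<rho>)) \<le> 1"
    using assms(1) psd_mat_trace(1)[OF P[of 0]] psd_mat_trace(1)[OF P[of 1]]
    by (auto simp: state_mat_iff)
  then show "state_mat (measure_branch m 0 \<rho>)" "state_mat (measure_branch m 1 \<rho>)"
    using C P by (auto simp: state_mat_iff)
qed

section \<open>Partial traces and new qubits\<close>

lemma state_mat_partial_trace1:
  assumes "state_mat \<rho>" "m \<in> {1..qubits \<rho>}"
  shows "state_mat (partial_trace1 m \<rho>)" "mat_trace (partial_trace1 m \<rho>) = mat_trace \<rho>"
    "qubits (partial_trace1 m \<rho>) = qubits \<rho> - 1"
proof -
  note b = state_mat_measure_branch[OF assms]
  have C: "partial_trace1 m \<rho> \<in> carrier_mat (2 ^ (qubits \<rho> - 1)) (2 ^ (qubits \<rho> - 1))"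
    unfolding partial_trace1_def by (intro add_carrier_mat b(3))
  then show "qubits (partial_trace1 m \<rho>) = qubits \<rho> - 1"
    by (rule qubits_eq)
  show T: "mat_trace (partial_trace1 m \<rho>) = mat_trace \<rho>"
    unfolding partial_trace1_def by (subst mat_trace_add[OF b(3) b(3)]) (rule b(4))
  have "psd_mat (partial_trace1 m \<rho>)"
    unfolding partial_trace1_def using b(1,2) by (intro psd_mat_add[OF _ _ b(3) b(3)]) (auto simp: state_mat_iff)
  then show "state_mat (partial_trace1 m \<rho>)"
    using assms C T by (auto simp: state_mat_iff)
qed

lemma state_mat_partial_trace:
  assumes "state_mat \<rho>" "Q \<subseteq> {1..qubits \<rho>}"
  shows "state_mat (partial_trace Q \<rho>)" "mat_trace (partial_trace Q \<rho>) = mat_trace \<rho>"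
proof -
  have "state_mat (foldr partial_trace1 ms \<rho>) \<and> mat_trace (foldr partial_trace1 ms \<rho>) = mat_trace \<rho> \<and>
      qubits (foldr partial_trace1 ms \<rho>) = qubits \<rho> - length ms"
    if "sorted_wrt (<) ms" "set ms \<subseteq> {1..qubits \<rho>}" for ms
    using that
  proof (induction ms)
    case Nil
    then show ?case using assms by simp
  next
    case (Cons m ms)
    \<comment> \<open>The qubits \<open>ms\<close> are traced out before \<open>m\<close>. All of
      them are larger than \<open>m\<close>, so at least \<open>m\<close> qubits are left and
      \<open>m\<close> is still a valid number.\<close>
    have "set ms \<subseteq> {m<..qubits \<rho>}"
      using Cons.prems by auto
    then have "card (set ms) \<le> qubits \<rho> - m"
      by (metis card_greaterThanAtMost card_mono finite_greaterThanAtMost)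
    moreover have "card (set ms) = length ms"
      using Cons.prems by (simp add: strict_sorted_iff distinct_card)
    moreover have "m \<in> {1..qubits \<rho>}"
      and IH: "state_mat (foldr partial_trace1 ms \<rho>)"
        "mat_trace (foldr partial_trace1 ms \<rho>) = mat_trace \<rho>"
        "qubits (foldr partial_trace1 ms \<rho>) = qubits \<rho> - length ms"
      using Cons by simp_all
    ultimately have "m \<in> {1..qubits (foldr partial_trace1 ms \<rho>)}"
      by auto
    from IH state_mat_partial_trace1[OF IH(1) this] show ?case
      by simp
  qed
  moreover have "finite Q"
    using assms finite_subset by blast
  ultimately show "state_mat (partial_trace Q \<rho>)" "mat_trace (partial_trace Q \<rho>) = mat_trace \<rho>"
    using assms(2) by (auto simp: partial_trace_def)
qed

text \<open>Appending a qubit in a basis state is conjugation by the isometry that tensors a vector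
  with \<open>ket i\<close> on the right, so \<open>state_mat_isometry\<close> applies to
  it.\<close>

lemma kron_ket_isometry:
  assumes "\<rho> \<in> carrier_mat (2 ^ n) (2 ^ n)" "i < 2"
  defines "K \<equiv> kron (1\<^sub>m (2 ^ n)) (ket i)"
  shows "kron \<rho> (ket i * mat_adjoint (ket i)) = K * \<rho> * mat_adjoint K"
    "K \<in> carrier_mat (2 ^ Suc n) (2 ^ n)" "mat_adjoint K * K = 1\<^sub>m (2 ^ n)"
proof -
  note k = ket_carrier[of i] and k' = mat_adjoint_carrier[OF ket_carrier[of i]]
  \<comment> \<open>Reading \<open>\<rho>\<close> as \<open>kron \<rho> (1\<^sub>m 1)\<close> makes
    the mixed-product rule applicable.\<close>
  have "K * \<rho> = kron \<rho> (ket i)"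
    using kron_mult[OF one_carrier_mat assms(1) k one_carrier_mat]
    unfolding K_def kron_one_right left_mult_one_mat[OF assms(1)] right_mult_one_mat[OF k] .
  then show "kron \<rho> (ket i * mat_adjoint (ket i)) = K * \<rho> * mat_adjoint K"
    using kron_mult[OF assms(1) one_carrier_mat k k']
    unfolding K_def kron_adjoint mat_adjoint_one right_mult_one_mat[OF assms(1)] by simp
  show "K \<in> carrier_mat (2 ^ Suc n) (2 ^ n)"
    using kron_carrier[OF one_carrier_mat[of "2 ^ n"] k] by (simp add: K_def mult.commute)
  show "mat_adjoint K * K = 1\<^sub>m (2 ^ n)"
    using kron_mult[OF one_carrier_mat[of "2 ^ n"] one_carrier_mat k' k]
    unfolding K_def kron_adjoint mat_adjoint_one right_mult_one_mat[OF one_carrier_mat]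
      ket_adjoint_ket[OF assms(2)] kron_one_right .
qed

lemma state_mat_new_qubit:
  assumes "state_mat \<rho>"
  shows "state_mat (kron \<rho> (ket 0 * mat_adjoint (ket 0)))"
    "mat_trace (kron \<rho> (ket 0 * mat_adjoint (ket 0))) = mat_trace \<rho>"
  using state_mat_isometry[OF assms] kron_ket_isometry[OF state_mat_carrier[OF assms], of 0]
  by (metis pos2)+

section \<open>Gates on selected qubits\<close>

lemma qubit_of_eq_bit: "qubit_of N k i = of_bool (bit i (N - k))"
  by (simp add: qubit_of_def bit_iff_odd mod_2_eq_odd)

lemma qubit_of_range: "qubit_of N k i \<in> {0, 1}"
  by (simp add: qubit_of_eq_bit)

lemma qubits_of_range: "set (map (\<lambda>m. qubit_of N m i) ms) \<subseteq> {0, 1}"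
  by (auto simp: qubit_of_eq_bit)

lemma qubit_of_eqI:
  assumes "i < 2 ^ N" "j < 2 ^ N" and eq: "\<And>k. k \<in> {1..N} \<Longrightarrow> qubit_of N k i = qubit_of N k j"
  shows "i = j"
proof -
  have "take_bit N i = i" "take_bit N j = j"
    using assms(1,2) by (simp_all add: take_bit_nat_eq_self)
  \<comment> \<open>Qubit \<open>1\<close> is the most significant bit, so bit \<open>n\<close> is
    the value of qubit \<open>N - n\<close>.\<close>
  moreover have "bit i n = bit j n" if "n < N" for n
    using eq[of "N - n"] that by (simp add: qubit_of_eq_bit Suc_le_eq of_bool_eq_iff)
  then have "take_bit N i = take_bit N j"
    by (auto simp: bit_eq_iff bit_take_bit_iff)
  ultimately show ?thesis
    by metis
qed

lemma qubit_of_surj: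
  assumes "\<And>k. k \<in> {1..N} \<Longrightarrow> b k \<in> {0, 1}"
  obtains i where "i < 2 ^ N" "\<And>k. k \<in> {1..N} \<Longrightarrow> qubit_of N k i = b k"
proof
  \<comment> \<open>\<open>horner_sum\<close> reads the least significant digit first, so position
    \<open>n\<close> holds the value prescribed for qubit \<open>N - n\<close>.\<close>
  let ?bs = "map (\<lambda>n. b (N - n) = 1) [0..<N]"
  let ?i = "horner_sum of_bool 2 ?bs :: nat"
  have "take_bit N ?i = ?i"
    by (auto simp: bit_eq_iff bit_take_bit_iff bit_horner_sum_bit_iff)
  then show "?i < 2 ^ N"
    by (metis take_bit_nat_less_exp)
  show "qubit_of N k ?i = b k" if "k \<in> {1..N}" for k
    using assms[OF that] that by (auto simp: qubit_of_eq_bit bit_horner_sum_bit_iff)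
qed

section \<open>Binary expansions and the indices of selected qubits\<close>

definition binary :: "nat list \<Rightarrow> nat" where
  "binary = foldl (\<lambda>a b. 2 * a + b) 0"

lemma binary_snoc [simp]: "binary (bs @ [b]) = 2 * binary bs + b"
  by (simp add: binary_def)

lemma binary_less: "set bs \<subseteq> {0, 1} \<Longrightarrow> binary bs < 2 ^ length bs"
proof (induction bs rule: rev_induct)
  case Nil
  then show ?case by (simp add: binary_def)
next
  case (snoc b bs)
  then show ?case by auto
qed

lemma binary_inj:
  assumes "length bs = length cs" "set bs \<subseteq> {0, 1}" "set cs \<subseteq> {0, 1}" "binary bs = binary cs"
  shows "bs = cs"
  using assms
proof (induction bs arbitrary: cs rule: rev_induct)
  case Nil
  then show ?case by simp
next
  case (snoc b bs)
  obtain cs' c where cs: "cs = cs' @ [c]"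
    using snoc.prems(1) by (cases cs rule: rev_cases) auto
  have "b \<in> {0, 1}" "c \<in> {0, 1}" "2 * binary bs + b = 2 * binary cs' + c"
    using snoc.prems cs by auto
  \<comment> \<open>Comparing parities isolates the last digit.\<close>
  then have "b = c" "binary bs = binary cs'"
    by (auto dest: arg_cong[of _ _ even])
  then show ?case
    using snoc cs by simp
qed

lemma binary_surj:
  assumes "a < 2 ^ n"
  obtains bs where "length bs = n" "set bs \<subseteq> {0, 1}" "binary bs = a"
proof -
  have "\<exists>bs. length bs = n \<and> set bs \<subseteq> {0, 1} \<and> binary bs = a"
    using assms
  proof (induction n arbitrary: a)
    case 0
    then show ?case by (simp add: binary_def)
  next
    case (Suc n)
    then have "a div 2 < 2 ^ n"
      by auto
    then obtain bs where "length bs = n" "set bs \<subseteq> {0, 1}" "binary bs = a div 2"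
      using Suc.IH by blast
    then show ?case
      by (intro exI[of _ "bs @ [a mod 2]"]) auto
  qed
  then show ?thesis
    using that by blast
qed

lemma subindex_binary: "subindex N ms i = binary (map (\<lambda>m. qubit_of N m i) ms)"
  by (simp add: subindex_def binary_def foldl_map)

lemma subindex_less: "subindex N ms i < 2 ^ length ms"
  using binary_less[OF qubits_of_range, of N i ms] by (simp add: subindex_binary)

lemma subindex_eqD:
  "subindex N ms i = subindex N ms j \<Longrightarrow> m \<in> set ms \<Longrightarrow> qubit_of N m i = qubit_of N m j"
  using binary_inj[OF _ qubits_of_range qubits_of_range, of N i ms N j ms]
  by (simp add: subindex_binary)

text \<open>Once the qubits outside \<open>ms\<close> are fixed to those of \<open>j\<close>, a
  basis state is freely and uniquely determined by its values on \<open>ms\<close>, and these are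
  the binary digits of its subindex.\<close>

lemma bij_betw_subindex:
  assumes "distinct ms" "set ms \<subseteq> {1..N}"
  shows "bij_betw (subindex N ms)
    {i. i < 2 ^ N \<and> (\<forall>k \<in> {1..N} - set ms. qubit_of N k i = qubit_of N k j)} {..<2 ^ length ms}"
proof (rule bij_betw_imageI)
  let ?I = "{i. i < 2 ^ N \<and> (\<forall>k \<in> {1..N} - set ms. qubit_of N k i = qubit_of N k j)}"
  show "inj_on (subindex N ms) ?I"
  proof (rule inj_onI)
    fix i i'
    assume I: "i \<in> ?I" "i' \<in> ?I" and eq: "subindex N ms i = subindex N ms i'"
    show "i = i'"
    proof (rule qubit_of_eqI)
      fix k
      assume "k \<in> {1..N}"
      then show "qubit_of N k i = qubit_of N k i'"
        using I subindex_eqD[OF eq, of k] by (cases "k \<in> set ms") auto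
    qed (use I in auto)
  qed
  show "subindex N ms ` ?I = {..<2 ^ length ms}"
  proof (intro equalityI subsetI)
    fix a :: nat
    assume "a \<in> {..<2 ^ length ms}"
    then obtain bs where bs: "length bs = length ms" "set bs \<subseteq> {0, 1}" "binary bs = a"
      using binary_surj by (metis lessThan_iff)
    \<comment> \<open>The bit pattern to be realized: the given digits on \<open>ms\<close>, and the
      values of \<open>j\<close> everywhere else.\<close>
    define b where "b k = (case map_of (zip ms bs) k of Some c \<Rightarrow> c | None \<Rightarrow> qubit_of N k j)" for k
    have "b k \<in> {0, 1}" for k
      using bs(2) qubit_of_range[of N k j]
      by (auto simp: b_def split: option.splits dest!: map_of_SomeD set_zip_rightD)
    then obtain i where i: "i < 2 ^ N" "\<And>k. k \<in> {1..N} \<Longrightarrow> qubit_of N k i = b k"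
      using qubit_of_surj[of N b] by blast
    have "b (ms ! n) = bs ! n" if "n < length ms" for n
      using that bs(1) assms(1) by (simp add: b_def map_of_zip_nth)
    then have "map (\<lambda>m. qubit_of N m i) ms = bs"
      using bs(1) i(2) assms(2) by (intro nth_equalityI) (simp_all add: subset_iff del: atLeastAtMost_iff)
    then have "subindex N ms i = a"
      using bs(3) by (simp add: subindex_binary)
    moreover have "b k = qubit_of N k j" if "k \<notin> set ms" for k
      using that by (auto simp: b_def split: option.split dest!: map_of_SomeD set_zip_leftD)
    then have "i \<in> ?I"
      using i by simp
    ultimately show "a \<in> subindex N ms ` ?I"
      by blast
  qed (auto simp: subindex_less)
qed

text \<open>Column \<open>j\<close> of the operator is supported on basis states that agree with
  \<open>j\<close> outside \<open>ms\<close>. Columns whose indices differ there are orthogonal; for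
  the others, \<open>bij_betw_subindex\<close> turns the inner product into that of two columns of
  \<open>S\<close>.\<close>

lemma act_on_isometry:
  assumes S: "S \<in> carrier_mat (2 ^ length ms) (2 ^ length ms)"
    and iso: "mat_adjoint S * S = 1\<^sub>m (2 ^ length ms)"
    and ms: "distinct ms" "set ms \<subseteq> {1..N}"
  shows "act_on N ms S \<in> carrier_mat (2 ^ N) (2 ^ N)"
    "mat_adjoint (act_on N ms S) * act_on N ms S = 1\<^sub>m (2 ^ N)"
proof -
  let ?U = "act_on N ms S" and ?s = "subindex N ms"
  define agree where "agree i j \<longleftrightarrow> (\<forall>k \<in> {1..N} - set ms. qubit_of N k i = qubit_of N k j)" for i j
  have U: "?U \<in> carrier_mat (2 ^ N) (2 ^ N)"
    "\<And>i j. i < 2 ^ N \<Longrightarrow> j < 2 ^ N \<Longrightarrow> ?U $$ (i, j) = (if agree i j then S $$ (?s i, ?s j) else 0)"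
    by (auto simp: act_on_def agree_def)
  show "?U \<in> carrier_mat (2 ^ N) (2 ^ N)"
    by (rule U)
  show "mat_adjoint ?U * ?U = 1\<^sub>m (2 ^ N)"
  proof (rule eq_matI)
    fix j k
    assume "j < dim_row (1\<^sub>m (2 ^ N) :: complex mat)" "k < dim_col (1\<^sub>m (2 ^ N) :: complex mat)"
    then have jk: "j < 2 ^ N" "k < 2 ^ N"
      by auto
    have "(mat_adjoint ?U * ?U) $$ (j, k) = (\<Sum>i<2 ^ N. cnj (?U $$ (i, j)) * ?U $$ (i, k))"
      using jk U(1) by (simp add: scalar_prod_def atLeast0LessThan)
    \<comment> \<open>Agreement outside \<open>ms\<close> is an equivalence relation, so for
      \<open>i\<close> agreeing with \<open>j\<close> the condition on \<open>k\<close> no longer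
      depends on \<open>i\<close>.\<close>
    also have "\<dots> = (\<Sum>i<2 ^ N. if agree i j then
        if agree j k then cnj (S $$ (?s i, ?s j)) * S $$ (?s i, ?s k) else 0 else 0)"
      using jk U(2) by (intro sum.cong refl) (auto simp: agree_def)
    also have "\<dots> = (if j = k then 1 else 0)"
    proof (cases "agree j k")
      case True
      let ?f = "\<lambda>a. cnj (S $$ (a, ?s j)) * S $$ (a, ?s k)"
      have "(\<Sum>i<2 ^ N. if agree i j then
          if agree j k then ?f (?s i) else 0 else 0) = (\<Sum>i\<in>{i. i < 2 ^ N \<and> agree i j}. ?f (?s i))"
        using True by (subst sum.inter_filter[symmetric]) (auto intro!: sum.cong)
      also have "\<dots> = (\<Sum>a<2 ^ length ms. ?f a)"
        using sum.reindex_bij_betw[OF bij_betw_subindex[OF ms, of j], of ?f] by (simp add: agree_def)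
      also have "\<dots> = (mat_adjoint S * S) $$ (?s j, ?s k)"
        using S by (simp add: scalar_prod_def atLeast0LessThan subindex_less)
      also have "\<dots> = (if ?s j = ?s k then 1 else 0)"
        by (simp add: iso subindex_less)
      \<comment> \<open>Both indices agree with \<open>k\<close> outside \<open>ms\<close>, and on
        the set of such indices the subindex map is injective.\<close>
      also have "?s j = ?s k \<longleftrightarrow> j = k"
        using True jk
        by (intro inj_on_eq_iff[OF bij_betw_imp_inj_on[OF bij_betw_subindex[OF ms, of k]]])
          (auto simp: agree_def)
      finally show ?thesis .
    next
      case False
      then have "j \<noteq> k"
        by (auto simp: agree_def)
      then show ?thesis
        using False by simp
    qed
    finally show "(mat_adjoint ?U * ?U) $$ (j, k) = 1\<^sub>m (2 ^ N) $$ (j, k)"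
      using jk by simp
  qed (use U(1) in auto)
qed

lemma state_mat_apply_gate:
  assumes "state_mat \<rho>" "distinct ms" "set ms \<subseteq> {1..qubits \<rho>}" "length ms = arity S"
  shows "state_mat (apply_gate ms (gate_mat S) \<rho>)"
    "mat_trace (apply_gate ms (gate_mat S) \<rho>) = mat_trace \<rho>"
proof -
  obtain n where S: "gate_mat S \<in> carrier_mat (2 ^ n) (2 ^ n)" "unitary_mat (gate_mat S)"
    using gate_mat[of S] by blast
  then have "n = length ms"
    using assms(4) by (simp add: arity_def qubits_eq)
  then have "gate_mat S \<in> carrier_mat (2 ^ length ms) (2 ^ length ms)"
    "mat_adjoint (gate_mat S) * gate_mat S = 1\<^sub>m (2 ^ length ms)"
    using S by (auto simp: unitary_mat_def)
  note U = act_on_isometry[OF this assms(2,3)]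
  show "state_mat (apply_gate ms (gate_mat S) \<rho>)"
    "mat_trace (apply_gate ms (gate_mat S) \<rho>) = mat_trace \<rho>"
    unfolding apply_gate_def using state_mat_isometry[OF assms(1) U] by simp_all
qed

section \<open>Fresh names\<close>

lemma infinite_var: "infinite (UNIV :: var set)"
  by (rule infinite_UNIV_listI)

lemma finite_vars: "finite (vars M)"
  by (induction M) auto

lemma finite_injection_avoiding:
  fixes F :: "'a set" and X :: "'b set"
  assumes "infinite (UNIV :: 'b set)" "finite X" "finite F"
  obtains g where "inj_on g F" "g ` F \<inter> X = {}"
proof -
  have "infinite (- X)"
    using assms(1,2) by (simp add: Compl_eq_Diff_UNIV)
  then obtain B where "finite B" "card B = card F" "B \<subseteq> - X"
    using infinite_arbitrarily_large by blast
  then obtain g where "bij_betw g F B"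
    using assms(3) by (metis finite_same_card_bij)
  with \<open>B \<subseteq> - X\<close> show thesis
    by (intro that[of g]) (auto simp: bij_betw_def)
qed

text \<open>The sets \<open>B - A\<close> and \<open>A - B\<close> have the same finite size, so the
  elements of the first can be sent to those of the second. This closes \<open>h\<close> up to a
  permutation of \<open>A \<union> B\<close>; all other names stay fixed.\<close>

lemma bij_betw_extends_to_bij:
  assumes h: "bij_betw h A B" and "finite A" and "A \<inter> X = {}" "B \<inter> X = {}"
  obtains \<pi> where "bij \<pi>" "\<And>x. x \<in> A \<Longrightarrow> \<pi> x = h x" "\<And>x. x \<in> X \<Longrightarrow> \<pi> x = x"
proof -
  have B: "finite B" "card A = card B"
    using h \<open>finite A\<close> by (auto simp: bij_betw_finite bij_betw_same_card)
  then have "card (B - A) = card (A - B)"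
    using \<open>finite A\<close> by (metis card_le_sym_Diff le_antisym order_refl)
  then obtain g where g: "bij_betw g (B - A) (A - B)"
    using B(1) \<open>finite A\<close> by (metis finite_Diff finite_same_card_bij)
  define \<pi> where "\<pi> x = (if x \<in> A then h x else if x \<in> B then g x else x)" for x
  have "bij_betw \<pi> A B \<longleftrightarrow> bij_betw h A B"
    by (rule bij_betw_cong) (simp add: \<pi>_def)
  moreover have "bij_betw \<pi> (B - A) (A - B) \<longleftrightarrow> bij_betw g (B - A) (A - B)"
    by (rule bij_betw_cong) (simp add: \<pi>_def)
  ultimately have "bij_betw \<pi> (A \<union> (B - A)) (B \<union> (A - B))"
    using h g by (intro bij_betw_combine) auto
  moreover have "bij_betw \<pi> (- (A \<union> B)) (- (A \<union> B))"
    by (simp add: \<pi>_def bij_betw_def inj_on_def image_def)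
  ultimately have "bij_betw \<pi> (A \<union> (B - A) \<union> - (A \<union> B)) (B \<union> (A - B) \<union> - (A \<union> B))"
    by (rule bij_betw_combine) auto
  moreover have "A \<union> (B - A) \<union> - (A \<union> B) = UNIV" "B \<union> (A - B) \<union> - (A \<union> B) = UNIV"
    by auto
  ultimately have "bij \<pi>"
    by simp
  then show thesis
    using assms(3,4) by (intro that[of \<pi>]) (auto simp: \<pi>_def)
qed

lemma rename_fixed: "(\<And>x. x \<in> vars M \<Longrightarrow> \<pi> x = x) \<Longrightarrow> rename \<pi> M = M"
  by (metis trm.map_ident_strong)

lemma call_renaming_exists:
  assumes "finite X"
  obtains r where "call_renaming X x1 y1 x2 y2 M r"
proof -
  obtain g where g: "inj_on g (vars M - {x2, y2})" "g ` (vars M - {x2, y2}) \<inter> X = {}"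
    using finite_injection_avoiding[OF infinite_var assms, of "vars M - {x2, y2}"] finite_vars by blast
  \<comment> \<open>The test for \<open>x2\<close> comes first, so that a variable serving as both
    input and output goes to \<open>x1\<close>.\<close>
  define r where "r v = (if v = x2 then x1 else if v = y2 then y1 else g v)" for v
  have "r v = g v" if "v \<in> vars M - {x2, y2}" for v
    using that by (simp add: r_def)
  then have "inj_on r (vars M - {x2, y2})" "r ` (vars M - {x2, y2}) = g ` (vars M - {x2, y2})"
    using g(1) inj_on_cong by (blast, auto)
  then have "call_renaming X x1 y1 x2 y2 M r"
    using g(2) by (simp add: call_renaming_def r_def)
  then show thesis
    by (rule that)
qed

text \<open>Undoing \<open>r\<close> and then applying \<open>r'\<close> is a bijection between two
  finite sets of fresh names, both disjoint from \<open>X\<close>, and it extends to a permutation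
  that fixes \<open>X\<close>. The images of the formal variables lie in \<open>X\<close> and are
  therefore not moved.\<close>

lemma call_renaming_unique:
  assumes r: "call_renaming X x1 y1 x2 y2 M r" and r': "call_renaming X x1 y1 x2 y2 M r'"
    and X: "x1 \<in> X" "y1 \<in> X"
  obtains \<pi> where "bij \<pi>" "\<And>x. x \<in> X \<Longrightarrow> \<pi> x = x" "rename r' M = rename \<pi> (rename r M)"
proof -
  let ?F = "vars M - {x2, y2}"
  let ?h = "r' \<circ> inv_into ?F r"
  have "bij_betw (inv_into ?F r) (r ` ?F) ?F" "bij_betw r' ?F (r' ` ?F)"
    using r r' by (auto simp: call_renaming_def intro!: bij_betw_inv_into inj_on_imp_bij_betw)
  then have "bij_betw ?h (r ` ?F) (r' ` ?F)"
    by (rule bij_betw_trans)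
  moreover have "finite (r ` ?F)" "r ` ?F \<inter> X = {}" "r' ` ?F \<inter> X = {}"
    using r r' finite_vars[of M] by (simp_all add: call_renaming_def)
  ultimately obtain \<pi> where \<pi>: "bij \<pi>" "\<And>x. x \<in> r ` ?F \<Longrightarrow> \<pi> x = ?h x" "\<And>x. x \<in> X \<Longrightarrow> \<pi> x = x"
    by (rule bij_betw_extends_to_bij) blast+
  have "r' v = \<pi> (r v)" if "v \<in> vars M" for v
  proof (cases "v \<in> ?F")
    case True
    then show ?thesis
      using \<pi>(2)[of "r v"] r by (simp add: call_renaming_def)
  next
    case False
    then show ?thesis
      using r r' X \<pi>(3) that by (auto simp: call_renaming_def)
  qed
  then have "rename r' M = rename \<pi> (rename r M)"
    by (auto simp: trm.map_comp intro: trm.map_cong)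
  then show thesis
    using \<pi>(1,3) that by blast
qed

section \<open>Values and assignments\<close>

text \<open>Canonical forms: the type of a value determines its outermost constructor, which is what
  the eliminating commands match on.\<close>

inductive_cases val_typed_TQbit: "val_typed Q v TQbit"
inductive_cases val_typed_TSum: "val_typed Q v (TSum A B)"
inductive_cases val_typed_TTensor: "val_typed Q v (TTensor A B)"
inductive_cases val_typed_TMu: "val_typed Q v (TMu A)"

primrec pointers :: "val \<Rightarrow> nat set" where
  "pointers VUnit = {}"
| "pointers (VPtr n) = {n}"
| "pointers (VLeft A B v) = pointers v"
| "pointers (VRight A B v) = pointers v"
| "pointers (VPair v w) = pointers v \<union> pointers w"
| "pointers (VFold A v) = pointers v"

text \<open>The qubit context depends on the value alone, whatever its type. The discard rule leaves
  context and type open, so the uniqueness of its reduct rests on this.\<close>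

lemma val_typed_pointers: "val_typed Q v A \<Longrightarrow> Q = pointers v"
  by (induction rule: val_typed.induct) auto

lemma assignment_typed_dom: "assignment_typed Q \<Gamma> V \<Longrightarrow> dom V = dom \<Gamma>"
  by (simp add: assignment_typed_def)

text \<open>Splits off the value of a variable that a command consumes. Disjointness of the two
  qubit contexts is recorded since it makes pointers in different variables distinct.\<close>

lemma assignment_typed_updE:
  assumes "assignment_typed Q (\<Gamma>(x \<mapsto> A)) W" "x \<notin> dom \<Gamma>"
  obtains V v Q1 Q2 where "W = V(x \<mapsto> v)" "x \<notin> dom V" "val_typed Q1 v A"
    "assignment_typed Q2 \<Gamma> V" "Q1 \<inter> Q2 = {}" "Q = Q1 \<union> Q2"
proof -
  obtain Qs where dom: "dom W = insert x (dom \<Gamma>)"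
    and disj: "disjoint_family_on Qs (insert x (dom \<Gamma>))"
    and Q: "Q = (\<Union>z \<in> insert x (dom \<Gamma>). Qs z)"
    and typed: "\<forall>z \<in> insert x (dom \<Gamma>). val_typed (Qs z) (the (W z)) (the ((\<Gamma>(x \<mapsto> A)) z))"
    using assms(1) by (auto simp: assignment_typed_def)
  from dom have "x \<in> dom W"
    by simp
  then obtain v where v: "W x = Some v"
    by blast
  show thesis
  proof
    show "W = (W(x := None))(x \<mapsto> v)"
      using v by auto
    show "val_typed (Qs x) v A"
      using typed v by simp
    show "assignment_typed (\<Union>z \<in> dom \<Gamma>. Qs z) \<Gamma> (W(x := None))"
      unfolding assignment_typed_def
    proof (intro conjI exI[of _ Qs] ballI refl)
      show "dom (W(x := None)) = dom \<Gamma>"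
        using dom assms(2) by auto
      show "disjoint_family_on Qs (dom \<Gamma>)"
        using disj by (auto simp: disjoint_family_on_def)
      show "val_typed (Qs z) (the ((W(x := None)) z)) (the (\<Gamma> z))" if "z \<in> dom \<Gamma>" for z
        using that assms(2) typed by (metis fun_upd_other insertI2)
    qed
    have "Qs x \<inter> Qs z = {}" if "z \<in> dom \<Gamma>" for z
      using that assms(2) by (intro disjoint_family_onD[OF disj]) auto
    then show "Qs x \<inter> (\<Union>z \<in> dom \<Gamma>. Qs z) = {}"
      by blast
    show "Q = Qs x \<union> (\<Union>z \<in> dom \<Gamma>. Qs z)"
      by (simp add: Q)
  qed simp
qed

text \<open>Different variables have disjoint qubit contexts, so the pointers are pairwise distinct,
  as \<open>act_on_isometry\<close> requires.\<close>

lemma assignment_typed_upd_qbitsE: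
  assumes "assignment_typed Q (\<Gamma>(qs [\<mapsto>] replicate (length qs) TQbit)) W"
    "distinct qs" "set qs \<inter> dom \<Gamma> = {}"
  obtains V ms Q' where "W = V(qs [\<mapsto>] map VPtr ms)" "length ms = length qs" "distinct ms"
    "Q = set ms \<union> Q'" "set ms \<inter> Q' = {}" "assignment_typed Q' \<Gamma> V"
proof -
  have "\<exists>V ms Q'. W = V(qs [\<mapsto>] map VPtr ms) \<and> length ms = length qs \<and> distinct ms \<and>
      Q = set ms \<union> Q' \<and> set ms \<inter> Q' = {} \<and> assignment_typed Q' \<Gamma> V"
    using assms
  proof (induction qs arbitrary: \<Gamma>)
    case Nil
    then show ?case by auto
  next
    case (Cons q qs)
    \<comment> \<open>The update at the head \<open>q\<close> is the innermost one: the induction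
      hypothesis is used with \<open>q\<close> added to the context, and \<open>q\<close> is split
      off afterwards.\<close>
    have "assignment_typed Q ((\<Gamma>(q \<mapsto> TQbit))(qs [\<mapsto>] replicate (length qs) TQbit)) W"
      using Cons.prems(1) by (simp del: map_upds_twist)
    moreover have "distinct qs" "set qs \<inter> dom (\<Gamma>(q \<mapsto> TQbit)) = {}"
      using Cons.prems(2,3) by auto
    ultimately obtain V ms Q' where IH: "W = V(qs [\<mapsto>] map VPtr ms)" "length ms = length qs" "distinct ms"
      "Q = set ms \<union> Q'" "set ms \<inter> Q' = {}" "assignment_typed Q' (\<Gamma>(q \<mapsto> TQbit)) V"
      using Cons.IH by metis
    from IH(6) Cons.prems(3) obtain V' v Q1 Q2 where
      "V = V'(q \<mapsto> v)" "val_typed Q1 v TQbit" "assignment_typed Q2 \<Gamma> V'" "Q1 \<inter> Q2 = {}" "Q' = Q1 \<union> Q2"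
      by (elim assignment_typed_updE) auto
    moreover from this(2) obtain m where "Q1 = {m}" "v = VPtr m"
      by (elim val_typed_TQbit) auto
    ultimately show ?case
      using IH by (intro exI[of _ V'] exI[of _ "m # ms"] exI[of _ Q2]) auto
  qed
  then show thesis
    using that by blast
qed

text \<open>Every extension of a store uses a name outside \<open>dom \<Phi>\<close>, so no name is
  defined twice and a call finds exactly one body.\<close>

lemma store_typed_names: "store_typed \<Phi> \<Omega> \<Longrightarrow> fst ` \<Omega> = dom \<Phi> \<and> inj_on fst \<Omega>"
  by (induction rule: store_typed.induct) (auto simp: inj_on_def image_iff)

lemma finite_dom_upd: "finite (dom (V(x \<mapsto> v))) \<longleftrightarrow> finite (dom V)"
  by (metis dom_fun_upd finite_insert option.distinct(1))

text \<open>Uniqueness of the split by which a rule takes a variable out of the assignment; after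
  rule inversion it identifies the two reducts.\<close>

lemma upd_eqD:
  "V(x \<mapsto> v) = V'(x \<mapsto> v') \<Longrightarrow> V x = None \<Longrightarrow> V' x = None \<Longrightarrow> V = V' \<and> v = v'"
  by (metis fun_upd_same fun_upd_triv fun_upd_upd option.inject)

lemma upds_values:
  "distinct xs \<Longrightarrow> length vs = length xs \<Longrightarrow> map (V(xs [\<mapsto>] vs)) xs = map Some vs"
proof (induction xs arbitrary: V vs)
  case (Cons x xs)
  then show ?case
    by (cases vs) (simp_all del: map_upds_twist add: map_upds_apply_nontin)
qed simp

lemma upds_eq_imp_eq:
  assumes "V(xs [\<mapsto>] vs) = V'(xs [\<mapsto>] vs')" "distinct xs" "length vs = length xs" "length vs' = length xs"
  shows "vs = vs'"
proof -
  have "map Some vs = map Some vs'"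
    using assms by (metis upds_values)
  then show ?thesis
    by (simp add: inj_map_eq_map)
qed

section \<open>Representatives of the reducts\<close>

definition same_upto :: "var set \<Rightarrow> config \<Rightarrow> config \<Rightarrow> bool" where
  "same_upto X D D' \<longleftrightarrow>
     (\<exists>\<pi>. bij \<pi> \<and> (\<forall>x \<in> X. \<pi> x = x) \<and> fst D' = rename \<pi> (fst D)) \<and> snd D' = snd D"

lemma same_upto_refl: "same_upto X D D"
  by (auto simp: same_upto_def trm.map_id0 intro: exI[of _ id])

lemma same_upto_fresh_iff: "(D, D') \<in> same_upto_fresh C \<longleftrightarrow> same_upto (config_vars C) D D'"
  by (auto simp: same_upto_fresh_def same_upto_def)

text \<open>The set \<open>X\<close> of names to be avoided is kept apart from \<open>C\<close>, since an induction on sequential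
  compositions has to avoid the names of the whole configuration.\<close>

definition step_representatives :: "var set \<Rightarrow> config \<Rightarrow> config set \<Rightarrow> bool" where
  "step_representatives X C Ds \<longleftrightarrow>
     finite Ds \<and> Ds \<noteq> {} \<and> card Ds \<le> 2 \<and> inj_on snd Ds \<and>
     (\<forall>D \<in> Ds. step X C D \<and> configuration D) \<and>
     (\<forall>D'. step X C D' \<longrightarrow> (\<exists>D \<in> Ds. same_upto X D D')) \<and>
     config_trace C = (\<Sum>D \<in> Ds. config_trace D)"

text \<open>For commands whose only nondeterminism is the choice of fresh names, namely loops and
  calls; the deterministic commands are a special case.\<close>

lemma step_representatives_singleton:
  assumes "step X C D" "configuration D" "config_trace D = config_trace C"
    "\<And>D'. step X C D' \<Longrightarrow> same_upto X D D'"
  shows "\<exists>Ds. step_representatives X C Ds"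
  using assms by (intro exI[of _ "{D}"]) (simp add: step_representatives_def)

lemma step_representatives_det:
  assumes "step X C D" "configuration D" "config_trace D = config_trace C"
    "\<And>D'. step X C D' \<Longrightarrow> D' = D"
  shows "\<exists>Ds. step_representatives X C Ds"
  using assms same_upto_refl by (intro step_representatives_singleton) blast+

section \<open>Inversion of the reduction rules and progress\<close>

inductive_cases step_Skip: "step X (Skip, V, \<Omega>, \<rho>) D"
inductive_cases step_NewUnit: "step X (NewUnit u, V, \<Omega>, \<rho>) D"
inductive_cases step_Discard: "step X (Discard x, V, \<Omega>, \<rho>) D"
inductive_cases step_Copy: "step X (Copy y x, V, \<Omega>, \<rho>) D"
inductive_cases step_NewQbit: "step X (NewQbit q, V, \<Omega>, \<rho>) D"
inductive_cases step_Measure: "step X (Measure b q, V, \<Omega>, \<rho>) D"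
inductive_cases step_Apply: "step X (Apply qs S, V, \<Omega>, \<rho>) D"
inductive_cases step_Seq: "step X (Seq M N, V, \<Omega>, \<rho>) D"
inductive_cases step_While: "step X (While b M, V, \<Omega>, \<rho>) D"
inductive_cases step_InLeft: "step X (InLeft A B y x, V, \<Omega>, \<rho>) D"
inductive_cases step_InRight: "step X (InRight A B y x, V, \<Omega>, \<rho>) D"
inductive_cases step_Case: "step X (Case y x1 M1 x2 M2, V, \<Omega>, \<rho>) D"
inductive_cases step_Pair: "step X (Pair x x1 x2, V, \<Omega>, \<rho>) D"
inductive_cases step_Unpair: "step X (Unpair x1 x2 x, V, \<Omega>, \<rho>) D"
inductive_cases step_Fold: "step X (Fold A y x, V, \<Omega>, \<rho>) D"
inductive_cases step_Unfold: "step X (Unfold y x, V, \<Omega>, \<rho>) D"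
inductive_cases step_Proc: "step X (Proc f x A y B M, V, \<Omega>, \<rho>) D"
inductive_cases step_Call: "step X (Call y f x, V, \<Omega>, \<rho>) D"

text \<open>Appending \<open>N\<close> to each representative suffices: a permutation relating two
  reducts of \<open>M\<close> fixes \<open>X\<close> and hence \<open>N\<close>, so it relates the
  composed terms as well. If \<open>M\<close> were \<open>Skip\<close>, the other sequencing rule
  would apply.\<close>

lemma step_representatives_Seq:
  assumes "\<exists>Ds. step_representatives X (M, V, \<Omega>, \<rho>) Ds" "M \<noteq> Skip" "vars N \<subseteq> X"
  shows "\<exists>Ds. step_representatives X (Seq M N, V, \<Omega>, \<rho>) Ds"
proof -
  obtain Ds where Ds: "finite Ds" "Ds \<noteq> {}" "card Ds \<le> 2" "inj_on snd Ds"
    "\<forall>D \<in> Ds. step X (M, V, \<Omega>, \<rho>) D \<and> configuration D"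
    "\<forall>D'. step X (M, V, \<Omega>, \<rho>) D' \<longrightarrow> (\<exists>D \<in> Ds. same_upto X D D')"
    "config_trace (M, V, \<Omega>, \<rho>) = (\<Sum>D \<in> Ds. config_trace D)"
    using assms(1) by (auto simp: step_representatives_def)
  define s where "s D = (Seq (fst D) N, snd D)" for D :: config
  have inj: "inj_on s Ds"
    using Ds(4) by (auto simp: inj_on_def s_def)
  have "step_representatives X (Seq M N, V, \<Omega>, \<rho>) (s ` Ds)"
    unfolding step_representatives_def
  proof (intro conjI ballI allI impI)
    show "inj_on snd (s ` Ds)"
      using Ds(4) by (auto simp: inj_on_def s_def)
    show "card (s ` Ds) \<le> 2"
      using card_image_le[OF Ds(1), of s] Ds(3) by simp
    have "config_trace (s D) = config_trace D" for D
      by (simp add: config_trace_def s_def split_beta)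
    then show "config_trace (Seq M N, V, \<Omega>, \<rho>) = (\<Sum>D \<in> s ` Ds. config_trace D)"
      using Ds(7) by (simp add: sum.reindex[OF inj] config_trace_def)
    fix D
    show "step X (Seq M N, V, \<Omega>, \<rho>) D" "configuration D" if "D \<in> s ` Ds"
      using that Ds(5) step.seq2[of X M V \<Omega> \<rho> _ _ _ _ N]
      by (auto simp: s_def configuration_def)
    assume "step X (Seq M N, V, \<Omega>, \<rho>) D"
    then obtain D0 where "step X (M, V, \<Omega>, \<rho>) D0" "D = s D0"
      using assms(2) by (elim step_Seq) (auto simp: s_def)
    then obtain D1 where "D1 \<in> Ds" "same_upto X D1 D0" "D = s D0"
      using Ds(6) by blast
    moreover from this(2) obtain \<pi> where \<pi>: "bij \<pi>" "\<forall>x \<in> X. \<pi> x = x"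
        "fst D0 = rename \<pi> (fst D1)" "snd D0 = snd D1"
      by (auto simp: same_upto_def)
    then have "rename \<pi> N = N"
      using assms(3) by (intro rename_fixed) auto
    then have "same_upto X (s D1) (s D0)"
      using \<pi> by (auto simp: same_upto_def s_def)
    ultimately show "\<exists>D1 \<in> s ` Ds. same_upto X D1 D"
      by auto
  qed (use Ds(1,2) in auto)
  then show ?thesis ..
qed

text \<open>By induction on typing. \<open>X\<close> is only required to contain the variables of
  \<open>M\<close>, so the first part of a sequence can be treated with the same set. Bodies of
  loops, branches and procedures are not run within one step, so the induction hypothesis matters in
  the sequence case only.\<close>

lemma progress:
  assumes "typed \<Phi> \<Gamma> M \<Sigma>" "assignment_typed {1..qubits \<rho>} \<Gamma> W" "store_typed \<Phi> \<Omega>"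
    "finite (dom W)" "finite \<Omega>" "state_mat \<rho>" "finite X" "vars M \<subseteq> X" "M \<noteq> Skip"
  shows "\<exists>Ds. step_representatives X (M, W, \<Omega>, \<rho>) Ds"
  using assms
proof (induction rule: typed.induct)
  case (unit u \<Gamma> \<Phi>)
  then have "u \<notin> dom W"
    by (simp add: assignment_typed_dom)
  then show ?case
    using unit.prems
    by (intro step_representatives_det[OF step.unit])
      (auto simp: configuration_def config_trace_def elim: step_NewUnit)
next
  case (discard x \<Gamma> \<Phi> A)
  then obtain V v Q1 Q2 where V: "W = V(x \<mapsto> v)" "x \<notin> dom V" "val_typed Q1 v A"
    "{1..qubits \<rho>} = Q1 \<union> Q2"
    by (elim assignment_typed_updE) auto
  have tr: "state_mat (partial_trace Q1 \<rho>)" "mat_trace (partial_trace Q1 \<rho>) = mat_trace \<rho>"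
    using discard.prems(5) V(4) by (auto intro!: state_mat_partial_trace)
  have "D = (Skip, renumber Q1 V, \<Omega>, partial_trace Q1 \<rho>)"
    if "step X (Discard x, V(x \<mapsto> v), \<Omega>, \<rho>) D" for D
  proof -
    from that obtain V' v' Q A' where eq: "V(x \<mapsto> v) = V'(x \<mapsto> v')" and V': "x \<notin> dom V'"
      and Q: "val_typed Q v' A'" and D: "D = (Skip, renumber Q V', \<Omega>, partial_trace Q \<rho>)"
      by (elim step_Discard) blast
    from eq V' V(2) have "V' = V" "v' = v"
      by (auto dest!: upd_eqD)
    \<comment> \<open>The context chosen by the rule is forced to be the set of pointers of
      \<open>v\<close>.\<close>
    moreover from this Q V(3) have "Q = Q1"
      using val_typed_pointers by metis
    ultimately show ?thesis
      using D by simp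
  qed
  then show ?case
    using discard.prems(3,4) tr unfolding V(1) finite_dom_upd
    by (intro step_representatives_det[OF step.discard[OF V(2,3)]])
      (auto simp: configuration_def config_trace_def renumber_def)
next
  case (copy x \<Gamma> y P \<Phi>)
  then obtain V v Q1 Q2 where V: "W = V(x \<mapsto> v)" "x \<notin> dom V" "assignment_typed Q2 \<Gamma> V"
    by (elim assignment_typed_updE) auto
  moreover have "y \<notin> dom V"
    using copy.hyps assignment_typed_dom[OF V(3)] by simp
  ultimately show ?case
    using copy.prems(3-5) copy.hyps(3) unfolding V(1) finite_dom_upd
    by (intro step_representatives_det[OF step.copy])
      (auto simp: configuration_def config_trace_def dest!: upd_eqD elim!: step_Copy)
next
  case (skip \<Phi> \<Gamma>)
  then show ?case by simp
next
  case (seq \<Phi> \<Gamma> M \<Gamma>' N \<Sigma>)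
  show ?case
  proof (cases "M = Skip")
    case True
    \<comment> \<open>\<open>Skip\<close> has no reduct, so \<open>seq2\<close> cannot apply
      here.\<close>
    have "D = (N, W, \<Omega>, \<rho>)" if "step X (Seq Skip N, W, \<Omega>, \<rho>) D" for D
      using that by (elim step_Seq) (auto elim: step_Skip)
    then show ?thesis
      unfolding True using seq.prems(3-5)
      by (intro step_representatives_det[OF step.seq1])
        (auto simp: configuration_def config_trace_def)
  next
    case False
    then show ?thesis
      using seq by (intro step_representatives_Seq) (auto simp: configuration_def)
  qed
next
  case (while b \<Gamma> \<Phi> M)
  then obtain V v Q1 Q2 where V: "W = V(b \<mapsto> v)" "b \<notin> dom V"
    by (elim assignment_typed_updE) auto
  obtain u where u: "u \<notin> X"
    using ex_new_if_finite[OF infinite_var \<open>finite X\<close>] by blast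
  show ?case
    unfolding V(1)
  proof (rule step_representatives_singleton[OF step.while[OF V(2) u]])
    fix D
    assume "step X (While b M, V(b \<mapsto> v), \<Omega>, \<rho>) D"
    then obtain u' where u': "u' \<notin> X"
      and D: "D = (if_then u' b (Seq M (While b M)), V(b \<mapsto> v), \<Omega>, \<rho>)"
      by (elim step_While) auto
    \<comment> \<open>The map between the two chosen names extends to a permutation fixing
      \<open>X\<close>, which carries one reduct to the other.\<close>
    have "bij_betw (\<lambda>_. u') {u} {u'}"
      by (simp add: bij_betw_def)
    then obtain \<pi> where \<pi>: "bij \<pi>" "\<pi> u = u'" "\<And>x. x \<in> X \<Longrightarrow> \<pi> x = x"
      using bij_betw_extends_to_bij[of "\<lambda>_. u'" "{u}" "{u'}" X] u u' by auto
    have "b \<in> X" "vars M \<subseteq> X"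
      using while.prems(7) by auto
    then have "\<pi> b = b" "rename \<pi> M = M"
      using \<pi>(3) by (auto intro!: rename_fixed)
    then show "same_upto X (if_then u b (Seq M (While b M)), V(b \<mapsto> v), \<Omega>, \<rho>) D"
      using \<pi> by (auto simp: same_upto_def D if_then_def intro!: exI[of _ \<pi>])
  qed (use while.prems(3-5)[unfolded V(1) finite_dom_upd] in \<open>auto simp: configuration_def config_trace_def\<close>)
next
  case (qbit q \<Gamma> \<Phi>)
  then have "q \<notin> dom W"
    by (simp add: assignment_typed_dom)
  then show ?case
    using qbit.prems state_mat_new_qubit[of \<rho>]
    by (intro step_representatives_det[OF step.qbit])
      (auto simp: configuration_def config_trace_def elim: step_NewQbit)
next
  case (measure q \<Gamma> b \<Phi>)
  then obtain V v Q1 Q2 where V: "W = V(q \<mapsto> v)" "q \<notin> dom V" "val_typed Q1 v TQbit"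
    "assignment_typed Q2 \<Gamma> V" "{1..qubits \<rho>} = Q1 \<union> Q2"
    by (elim assignment_typed_updE) auto
  from V(3) obtain m where m: "Q1 = {m}" "v = VPtr m"
    by (elim val_typed_TQbit) auto
  have b: "b \<notin> dom V"
    using measure.hyps assignment_typed_dom[OF V(4)] by simp
  define D where "D i = (Skip :: var trm, (renumber {m} V)(b \<mapsto> if i = 0 then VFalse else VTrue), \<Omega>,
    measure_branch m i \<rho>)" for i :: nat
  have "m \<in> {1..qubits \<rho>}"
    using V(5) m(1) by blast
  note branch = state_mat_measure_branch[OF measure.prems(5) this]
  \<comment> \<open>Even if both branches leave the same matrix, the bit stored in \<open>b\<close>
    separates the assignments.\<close>
  have "snd (D 0) \<noteq> snd (D 1)"
  proof
    assume "snd (D 0) = snd (D 1)"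
    then have "fst (snd (D 0)) b = fst (snd (D 1)) b"
      by simp
    then show False
      by (simp add: D_def)
  qed
  then have "D 0 \<noteq> D 1" "inj_on snd {D 0, D 1}"
    by auto
  have conf: "configuration (D 0)" "configuration (D 1)"
    using measure.prems(3,4) branch unfolding V(1) finite_dom_upd by (auto simp: D_def configuration_def renumber_def)
  have steps: "step X (Measure b q, V(q \<mapsto> VPtr m), \<Omega>, \<rho>) D' \<longleftrightarrow> D' \<in> {D 0, D 1}" for D'
  proof
    assume "step X (Measure b q, V(q \<mapsto> VPtr m), \<Omega>, \<rho>) D'"
    then show "D' \<in> {D 0, D 1}"
      using V(2) by (elim step_Measure) (auto simp: D_def dest!: upd_eqD)
  next
    assume "D' \<in> {D 0, D 1}"
    then show "step X (Measure b q, V(q \<mapsto> VPtr m), \<Omega>, \<rho>) D'"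
      using step.measure0[OF V(2) b] step.measure1[OF V(2) b] by (auto simp: D_def)
  qed
  have "step_representatives X (Measure b q, V(q \<mapsto> VPtr m), \<Omega>, \<rho>) {D 0, D 1}"
    unfolding step_representatives_def steps
    using \<open>D 0 \<noteq> D 1\<close> \<open>inj_on snd {D 0, D 1}\<close> conf branch(4) same_upto_refl
    by (auto simp: config_trace_def D_def)
  then show ?case
    unfolding V(1) m(2) by blast
next
  case (unitary qs S \<Gamma> \<Gamma>' \<Phi>)
  then obtain V ms Q' where V: "W = V(qs [\<mapsto>] map VPtr ms)" "length ms = length qs" "distinct ms"
    "{1..qubits \<rho>} = set ms \<union> Q'" "assignment_typed Q' \<Gamma> V"
    by (metis assignment_typed_upd_qbitsE)
  have dom: "set qs \<inter> dom V = {}"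
    using unitary.hyps(3) assignment_typed_dom[OF V(5)] by simp
  have "set ms \<subseteq> {1..qubits \<rho>}"
    using V(4) by blast
  then have gate: "state_mat (apply_gate ms (gate_mat S) \<rho>)"
    "mat_trace (apply_gate ms (gate_mat S) \<rho>) = mat_trace \<rho>"
    using V(2,3) unitary.hyps(1) unitary.prems(5) by (simp_all add: state_mat_apply_gate)
  have "D = (Skip, W, \<Omega>, apply_gate ms (gate_mat S) \<rho>)" if "step X (Apply qs S, W, \<Omega>, \<rho>) D" for D
  proof -
    from that obtain ms' V' where 1: "W = V'(qs [\<mapsto>] map VPtr ms')" "length ms' = length qs"
      "D = (Skip, W, \<Omega>, apply_gate ms' (gate_mat S) \<rho>)"
      by (rule step_Apply) (metis (no_types))
    \<comment> \<open>Both decompositions of \<open>W\<close> give its values at \<open>qs\<close>,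
      so the pointers are the same.\<close>
    then have "map VPtr ms' = map VPtr ms"
      using V(1,2) unitary.hyps(2) upds_eq_imp_eq by (metis length_map)
    then have "ms' = ms"
      by (simp add: inj_map_eq_map inj_def)
    then show ?thesis
      using 1(3) by simp
  qed
  then show ?case
    using gate unitary.prems(3,4)
    by (intro step_representatives_det[OF step.unitary[OF unitary.hyps(1) V(2) unitary.hyps(2) dom V(1)]])
      (auto simp: configuration_def config_trace_def)
next
  case (left x \<Gamma> y B \<Phi> A)
  then obtain V v Q1 Q2 where V: "W = V(x \<mapsto> v)" "x \<notin> dom V" "assignment_typed Q2 \<Gamma> V"
    by (elim assignment_typed_updE) auto
  moreover have "y \<notin> dom V"
    using left.hyps assignment_typed_dom[OF V(3)] by simp
  ultimately show ?case
    using left.prems(3-5) unfolding V(1) finite_dom_upd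
    by (intro step_representatives_det[OF step.left])
      (auto simp: configuration_def config_trace_def dest!: upd_eqD elim!: step_InLeft)
next
  case (right x \<Gamma> y A \<Phi> B)
  then obtain V v Q1 Q2 where V: "W = V(x \<mapsto> v)" "x \<notin> dom V" "assignment_typed Q2 \<Gamma> V"
    by (elim assignment_typed_updE) auto
  moreover have "y \<notin> dom V"
    using right.hyps assignment_typed_dom[OF V(3)] by simp
  ultimately show ?case
    using right.prems(3-5) unfolding V(1) finite_dom_upd
    by (intro step_representatives_det[OF step.right])
      (auto simp: configuration_def config_trace_def dest!: upd_eqD elim!: step_InRight)
next
  case (case_of y \<Gamma> x1 x2 \<Phi> A M1 \<Sigma> B M2)
  then obtain V v Q1 Q2 where V: "W = V(y \<mapsto> v)" "y \<notin> dom V" "val_typed Q1 v (TSum A B)"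
    "assignment_typed Q2 \<Gamma> V"
    by (elim assignment_typed_updE) auto
  have x: "x1 \<notin> dom V" "x2 \<notin> dom V"
    using case_of.hyps assignment_typed_dom[OF V(4)] by simp_all
  from V(3) consider w where "v = VLeft A B w" | w where "v = VRight A B w"
    by (elim val_typed_TSum) auto
  then show ?case
  proof cases
    case 1
    then show ?thesis
      using case_of.prems(3-5) V(2) x unfolding V(1) 1 finite_dom_upd
      by (intro step_representatives_det[OF step.case_left])
        (auto simp: configuration_def config_trace_def dest!: upd_eqD elim!: step_Case)
  next
    case 2
    then show ?thesis
      using case_of.prems(3-5) V(2) x unfolding V(1) 2 finite_dom_upd
      by (intro step_representatives_det[OF step.case_right])
        (auto simp: configuration_def config_trace_def dest!: upd_eqD elim!: step_Case)
  qed
next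
  case (pair x1 \<Gamma> x2 x \<Phi> A B)
  from pair.hyps have "x2 \<notin> dom (\<Gamma>(x1 \<mapsto> A))"
    by simp
  with pair.prems(1) obtain V' v2 Q2 where
    V': "W = V'(x2 \<mapsto> v2)" "x2 \<notin> dom V'" "assignment_typed Q2 (\<Gamma>(x1 \<mapsto> A)) V'"
    by (rule assignment_typed_updE) blast
  from V'(3) pair.hyps(1) obtain V v1 Q4 where
    V: "V' = V(x1 \<mapsto> v1)" "x1 \<notin> dom V" "assignment_typed Q4 \<Gamma> V"
    by (rule assignment_typed_updE) blast
  have x: "x2 \<notin> dom V" "x \<notin> dom V"
    using pair.hyps assignment_typed_dom[OF V(3)] by simp_all
  have "D = (Skip, V(x \<mapsto> VPair v1 v2), \<Omega>, \<rho>)"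
    if "step X (Pair x x1 x2, V(x1 \<mapsto> v1, x2 \<mapsto> v2), \<Omega>, \<rho>) D" for D
  proof -
    from that obtain V'' v1' v2' where
      eq: "V(x1 \<mapsto> v1, x2 \<mapsto> v2) = V''(x1 \<mapsto> v1', x2 \<mapsto> v2')"
      and V'': "x1 \<notin> dom V''" "x2 \<notin> dom V''"
      and D: "D = (Skip, V''(x \<mapsto> VPair v1' v2'), \<Omega>, \<rho>)"
      by (elim step_Pair) blast
    \<comment> \<open>The outer update at \<open>x2\<close> is peeled off first; as
      \<open>x1 \<noteq> x2\<close>, the inner assignments are undefined at
      \<open>x2\<close>.\<close>
    from eq x V'' pair.hyps(3) have "V(x1 \<mapsto> v1) = V''(x1 \<mapsto> v1')" "v2 = v2'"
      by (auto dest!: upd_eqD)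
    then have "V = V''" "v1 = v1'"
      using V(2) V'' by (auto dest!: upd_eqD)
    then show ?thesis
      using D \<open>v2 = v2'\<close> by simp
  qed
  then show ?case
    using pair.prems(3-5) V(2) x pair.hyps(3) unfolding V'(1) V(1) finite_dom_upd
    by (intro step_representatives_det[OF step.pair])
      (auto simp: configuration_def config_trace_def)
next
  case (unpair x1 \<Gamma> x2 x \<Phi> A B)
  then obtain V v Q1 Q2 where V: "W = V(x \<mapsto> v)" "x \<notin> dom V" "val_typed Q1 v (TTensor A B)"
    "assignment_typed Q2 \<Gamma> V"
    by (elim assignment_typed_updE) auto
  from V(3) obtain v1 v2 where v: "v = VPair v1 v2"
    by (elim val_typed_TTensor) auto
  have "x1 \<notin> dom V" "x2 \<notin> dom V"
    using unpair.hyps assignment_typed_dom[OF V(4)] by simp_all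
  then show ?case
    using unpair.prems(3-5) V(2) unpair.hyps(3) unfolding V(1) v finite_dom_upd
    by (intro step_representatives_det[OF step.unpair])
      (auto simp: configuration_def config_trace_def dest!: upd_eqD elim!: step_Unpair)
next
  case (fold x \<Gamma> y A \<Phi>)
  then obtain V v Q1 Q2 where V: "W = V(x \<mapsto> v)" "x \<notin> dom V" "assignment_typed Q2 \<Gamma> V"
    by (elim assignment_typed_updE) auto
  moreover have "y \<notin> dom V"
    using fold.hyps assignment_typed_dom[OF V(3)] by simp
  ultimately show ?case
    using fold.prems(3-5) unfolding V(1) finite_dom_upd
    by (intro step_representatives_det[OF step.fold])
      (auto simp: configuration_def config_trace_def dest!: upd_eqD elim!: step_Fold)
next
  case (unfold x \<Gamma> y \<Phi> A)
  then obtain V v Q1 Q2 where V: "W = V(x \<mapsto> v)" "x \<notin> dom V" "val_typed Q1 v (TMu A)"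
    "assignment_typed Q2 \<Gamma> V"
    by (elim assignment_typed_updE) auto
  from V(3) obtain w where v: "v = VFold A w"
    by (elim val_typed_TMu) auto
  have "y \<notin> dom V"
    using unfold.hyps assignment_typed_dom[OF V(4)] by simp
  then show ?case
    using unfold.prems(3-5) V(2) unfolding V(1) v finite_dom_upd
    by (intro step_representatives_det[OF step.unfold])
      (auto simp: configuration_def config_trace_def dest!: upd_eqD elim!: step_Unfold)
next
  case (proc f \<Phi> A B x M y \<Gamma>)
  then show ?case
    by (intro step_representatives_det[OF step.proc])
      (auto simp: configuration_def config_trace_def elim: step_Proc)
next
  case (call \<Phi> f A B x \<Gamma> y)
  then obtain V v Q1 Q2 where V: "W = V(x \<mapsto> v)" "x \<notin> dom V"
    by (elim assignment_typed_updE) auto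
  note names = store_typed_names[OF \<open>store_typed \<Phi> \<Omega>\<close>]
  from names call.hyps(1) have "f \<in> fst ` \<Omega>"
    by auto
  then obtain x2 A2 y2 B2 M where defn: "(f, x2, A2, y2, B2, M) \<in> \<Omega>"
    by force
  obtain r where r: "call_renaming X x y x2 y2 M r"
    using call_renaming_exists \<open>finite X\<close> by blast
  show ?case
    unfolding V(1)
  proof (rule step_representatives_singleton[OF step.call[OF V(2) defn r]])
    fix D
    assume "step X (Call y f x, V(x \<mapsto> v), \<Omega>, \<rho>) D"
    then obtain x2' A2' y2' B2' M' r' where defn': "(f, x2', A2', y2', B2', M') \<in> \<Omega>"
      and r': "call_renaming X x y x2' y2' M' r'"
      and D: "D = (rename r' M', V(x \<mapsto> v), \<Omega>, \<rho>)"
      by (elim step_Call) metis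
    \<comment> \<open>A name has only one definition in the store, so both calls run the same body
      and differ in the renaming only.\<close>
    have "(f, x2', A2', y2', B2', M') = (f, x2, A2, y2, B2, M)"
      using inj_onD[OF conjunct2[OF names] _ defn' defn] by simp
    with r' have "call_renaming X x y x2 y2 M r'" "M' = M"
      by simp_all
    moreover have "x \<in> X" "y \<in> X"
      using call.prems(7) by auto
    ultimately obtain \<pi> where "bij \<pi>" "\<And>z. z \<in> X \<Longrightarrow> \<pi> z = z" "rename r' M' = rename \<pi> (rename r M)"
      using call_renaming_unique[OF r] by metis
    then show "same_upto X (rename r M, V(x \<mapsto> v), \<Omega>, \<rho>) D"
      by (auto simp: same_upto_def D)
  qed (use call.prems(3-5)[unfolded V(1) finite_dom_upd] in \<open>auto simp: configuration_def config_trace_def\<close>)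
qed

section \<open>From representatives to classes of reducts\<close>

lemma finite_config_vars: "configuration C \<Longrightarrow> finite (config_vars C)"
  by (auto simp: configuration_def config_vars_def finite_vars)

text \<open>\<open>Ds\<close> is in bijection with the classes: every reduct is equivalent to a
  member of \<open>Ds\<close>, and distinct members are inequivalent. The trace is constant on each
  class because equivalent configurations share their matrix, so \<open>the_elem\<close> returns
  that common value.\<close>

lemma step_representatives_reducts:
  assumes "step_representatives (config_vars C) C Ds" "configuration C"
  shows "\<exists>D. C \<leadsto> D" "finite (reducts C)" "card (reducts C) \<le> 2"
    "config_trace C = (\<Sum>K \<in> reducts C. the_elem (config_trace ` K))"
proof -
  let ?R = "same_upto_fresh C"
  let ?cls = "\<lambda>D. ?R `` {D}"
  have Ds: "finite Ds" "Ds \<noteq> {}" "card Ds \<le> 2" "inj_on snd Ds"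
    and red: "\<And>D. D \<in> Ds \<Longrightarrow> C \<leadsto> D"
    and repr: "\<And>D'. C \<leadsto> D' \<Longrightarrow> \<exists>D \<in> Ds. (D, D') \<in> ?R"
    and tr: "config_trace C = (\<Sum>D \<in> Ds. config_trace D)"
    using assms by (auto simp: step_representatives_def reduces_def same_upto_fresh_iff)
  show "\<exists>D. C \<leadsto> D"
    using Ds(2) red by blast
  have reducts: "reducts C = ?cls ` Ds"
  proof
    show "?cls ` Ds \<subseteq> reducts C"
      unfolding reducts_def using red by (intro image_subsetI quotientI) simp
    show "reducts C \<subseteq> ?cls ` Ds"
    proof
      fix K
      assume "K \<in> reducts C"
      then obtain D' where "C \<leadsto> D'" "K = ?cls D'"
        by (auto simp: reducts_def quotient_def)
      then obtain D where "D \<in> Ds" "(D, D') \<in> ?R"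
        using repr by blast
      then show "K \<in> ?cls ` Ds"
        using \<open>K = ?cls D'\<close> equiv_class_eq[OF equiv_same_upto_fresh] by blast
    qed
  qed
  show "finite (reducts C)" "card (reducts C) \<le> 2"
    using Ds(1,3) card_image_le[OF Ds(1), of ?cls] by (auto simp: reducts)
  \<comment> \<open>Equivalent configurations differ at most in the term, so injectivity of
    \<open>snd\<close> on \<open>Ds\<close> keeps the classes apart.\<close>
  have "inj_on ?cls Ds"
  proof (rule inj_onI)
    fix D D'
    assume D: "D \<in> Ds" "D' \<in> Ds" "?cls D = ?cls D'"
    then have "(D, D') \<in> ?R"
      using eq_equiv_class[OF D(3) equiv_same_upto_fresh] by simp
    then have "snd D = snd D'"
      by (simp add: same_upto_fresh_iff same_upto_def)
    then show "D = D'"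
      using D Ds(4) by (auto dest: inj_onD)
  qed
  moreover have "the_elem (config_trace ` ?cls D) = config_trace D" for D
  proof -
    have "config_trace ` ?cls D = {config_trace D}"
    proof
      show "config_trace ` ?cls D \<subseteq> {config_trace D}"
        by (auto simp: same_upto_fresh_iff same_upto_def config_trace_def split_beta)
      have "D \<in> ?cls D"
        by (simp add: same_upto_fresh_iff same_upto_refl)
      then show "{config_trace D} \<subseteq> config_trace ` ?cls D"
        by blast
    qed
    then show ?thesis
      by simp
  qed
  ultimately show "config_trace C = (\<Sum>K \<in> reducts C. the_elem (config_trace ` K))"
    by (simp add: reducts sum.reindex tr)
qed

text \<open>Reducts are counted as classes modulo the choice of fresh names. Finiteness is asserted
  explicitly because the cardinality of an infinite set and a sum over it are 0 by
  convention.\<close>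

theorem theorem2:
  fixes \<Phi> :: proc_ctx and \<Gamma> \<Sigma> :: var_ctx and Q :: "nat set" and C :: config
  assumes "wf_config \<Phi> \<Gamma> \<Sigma> Q C"
  shows "(terminal C \<or> (\<exists>D. C \<leadsto> D)) \<and>
    (\<not> terminal C \<longrightarrow>
      finite (reducts C) \<and> card (reducts C) \<le> 2 \<and>
      config_trace C = (\<Sum>K \<in> reducts C. the_elem (config_trace ` K)))"
proof (cases "terminal C")
  case True
  then show ?thesis by simp
next
  case False
  obtain M V \<Omega> \<rho> where C: "C = (M, V, \<Omega>, \<rho>)"
    by (metis prod_cases4)
  have conf: "configuration C" and typed: "typed \<Phi> \<Gamma> M \<Sigma>" "assignment_typed {1..qubits \<rho>} \<Gamma> V"
    "store_typed \<Phi> \<Omega>"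
    using assms by (auto simp: wf_config_def C)
  have "vars M \<subseteq> config_vars C" "M \<noteq> Skip"
    using False by (auto simp: config_vars_def terminal_def C)
  moreover have "finite (dom V)" "finite \<Omega>" "state_mat \<rho>"
    using conf by (simp_all add: configuration_def C)
  ultimately obtain Ds where "step_representatives (config_vars C) C Ds"
    using progress[OF typed _ _ _ finite_config_vars[OF conf]] unfolding C by blast
  from step_representatives_reducts[OF this conf] show ?thesis
    by blast
qed

end
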